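(* Let $J\ge1$, let $\xi_0,\xi_1,\dots,\xi_J$ be independent standard normal random variables, $Y_j=\xi_j-\xi_0$ for $j=0,\dots,J$, and let $(V_j)_{j=0,\dots,J}$ be the value process of the optimal stopping problem for $Y$, $$V_j=\sup_{\sigma\in\mathcal{S}_J,\ \sigma\ge j}\mathbb{E}[Y_\sigma\mid\mathcal{F}_j],\qquad j=0,1,\dots,J.$$ Then for all $j\in\{1,\dots,J-1\}$, $$V_j=\max\Big\{\xi_j-\xi_0,\ \mu_{j+1}+\frac{j}{j+1}\big(\overline{\xi_{1:j}}-\xi_0\big)\Big\}\quad\text{almost surely},$$ and $V_0=\mu_1$, where $$\mu_J=0,\qquad \mu_j=\sqrt{\frac{j}{j+1}}\ \gamma\Big(\mu_{j+1}\sqrt{\frac{j+1}{j}}\Big),\quad j=J-1,J-2,\dots,1,$$ with $\gamma(x)=\phi(x)+x\Phi(x)$, where $\Phi$ and $\phi$ are the cumulative distribution function and the probability density function of the standard normal distribution.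
   Context: $\overline{\xi_{1:j}}=\frac1j\sum_{k=1}^j\xi_k$. The filtration is $\mathcal{F}_0=\{\emptyset,\Omega\}$ and $\mathcal{F}_j=\sigma(\xi_1-\xi_0,\dots,\xi_j-\xi_0)$ for $j=1,\dots,J$. $\mathcal{S}_J$ is the set of $\{0,1,\dots,J\}$-valued stopping times with respect to $(\mathcal{F}_j)_{j=0,\dots,J}$. The supremum defining $V_j$ is an essential supremum. *)

theory Defs
  imports "HOL-Probability.Probability"
begin

text \<open>
  Essential supremum of a (possibly uncountable) family of extended-real functions, as opposed to
  \<open>esssup\<close> of a single function. It is determined only up to null sets, hence a predicate;
  existence and uniqueness are shown below.
\<close>

definition is_ess_Sup :: "'a measure \<Rightarrow> ('a \<Rightarrow> ereal) set \<Rightarrow> ('a \<Rightarrow> ereal) \<Rightarrow> bool" where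
  "is_ess_Sup N S g \<longleftrightarrow>
     g \<in> borel_measurable N \<and>
     (\<forall>f\<in>S. AE \<omega> in N. f \<omega> \<le> g \<omega>) \<and>
     (\<forall>h\<in>borel_measurable N. (\<forall>f\<in>S. AE \<omega> in N. f \<omega> \<le> h \<omega>) \<longrightarrow> (AE \<omega> in N. g \<omega> \<le> h \<omega>))"

lemma is_ess_Sup_unique:
  assumes "is_ess_Sup N S g" and "is_ess_Sup N S h"
  shows "AE \<omega> in N. g \<omega> = h \<omega>"
proof -
  have "AE \<omega> in N. g \<omega> \<le> h \<omega>" "AE \<omega> in N. h \<omega> \<le> g \<omega>"
    using assms unfolding is_ess_Sup_def by blast+
  then show ?thesis
    by eventually_elim (rule antisym)
qed

lemma (in finite_measure) ex_countable_essential_Union: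
  assumes T: "T \<subseteq> sets M"
  shows "\<exists>B\<subseteq>T. countable B \<and> (\<forall>X\<in>T. X - \<Union>B \<in> null_sets M)"
proof -
  define C where "C = {B. B \<subseteq> T \<and> countable B}"
  define m where "m = (SUP B\<in>C. measure M (\<Union>B))"
  have C_sets: "\<Union>B \<in> sets M" if "B \<in> C" for B
    using that T by (intro sets.countable_Union) (auto simp: C_def)
  have bdd: "bdd_above ((\<lambda>B. measure M (\<Union>B)) ` C)"
    by (intro bdd_aboveI2[where M="measure M (space M)"] bounded_measure)
  have "{} \<in> C"
    by (auto simp: C_def)
  then have ne: "(\<lambda>B. measure M (\<Union>B)) ` C \<noteq> {}"
    by blast
  have "\<exists>B\<in>C. m - 1 / real (Suc n) < measure M (\<Union>B)" for n
    using less_cSUP_iff[OF _ bdd, of "m - 1 / real (Suc n)"] ne unfolding m_def by auto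
  then obtain B where B: "\<And>n. B n \<in> C" "\<And>n. m - 1 / real (Suc n) < measure M (\<Union>(B n))"
    by metis
  define D where "D = (\<Union>n. B n)"
  have D: "D \<in> C"
    using B(1) by (auto simp: D_def C_def)
  have m_le: "m \<le> measure M (\<Union>D)"
  proof (rule field_le_epsilon)
    fix e :: real assume "0 < e"
    then obtain n where n: "1 / real (Suc n) < e"
      using nat_approx_posE by blast
    have "measure M (\<Union>(B n)) \<le> measure M (\<Union>D)"
      using C_sets[OF D] by (intro finite_measure_mono) (auto simp: D_def)
    then show "m \<le> measure M (\<Union>D) + e"
      using B(2)[of n] n by linarith
  qed
  have "X - \<Union>D \<in> null_sets M" if X: "X \<in> T" for X
  proof -
    have ins: "insert X D \<in> C"
      using D X by (auto simp: C_def)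
    have X_sets: "X \<in> sets M"
      using X T by auto
    have "measure M (\<Union>(insert X D)) \<le> m"
      unfolding m_def using bdd ins by (intro cSUP_upper) auto
    moreover have "\<Union>(insert X D) = \<Union>D \<union> (X - \<Union>D)"
      by auto
    moreover have "measure M (\<Union>D \<union> (X - \<Union>D)) = measure M (\<Union>D) + measure M (X - \<Union>D)"
      using C_sets[OF D] X_sets by (intro finite_measure_Union) auto
    ultimately have "measure M (X - \<Union>D) \<le> 0"
      using m_le by simp
    then have "measure M (X - \<Union>D) = 0"
      by (simp add: antisym)
    then show ?thesis
      using C_sets[OF D] X_sets by (intro null_setsI) (auto simp: emeasure_eq_measure)
  qed
  then show ?thesis
    using D by (auto simp: C_def)
qed

lemma (in finite_measure) ex_is_ess_Sup:
  assumes S: "S \<subseteq> borel_measurable M"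
  shows "\<exists>g. is_ess_Sup M S g"
proof -
  define lev where "lev q f = {\<omega>\<in>space M. ereal (real_of_rat q) < f \<omega>}" for q and f :: "'a \<Rightarrow> ereal"
  have lev_sets: "lev q f \<in> sets M" if "f \<in> S" for q f
    using that S unfolding lev_def by (auto intro!: borel_measurable_less)
  have "\<exists>A\<subseteq>S. countable A \<and> (\<forall>f\<in>S. lev q f - (\<Union>h\<in>A. lev q h) \<in> null_sets M)" for q
  proof -
    have "lev q ` S \<subseteq> sets M"
      using lev_sets by auto
    from ex_countable_essential_Union[OF this] obtain B
      where B: "B \<subseteq> lev q ` S" "countable B" "\<forall>X\<in>lev q ` S. X - \<Union>B \<in> null_sets M"
      by metis
    from B(1,2) obtain A where A: "countable A" "A \<subseteq> S" "B = lev q ` A"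
      using countable_subset_image[of B "lev q" S] by metis
    have "\<forall>f\<in>S. lev q f - (\<Union>h\<in>A. lev q h) \<in> null_sets M"
      using B(3) A(3) by simp
    with A(1,2) show ?thesis
      by metis
  qed
  then obtain A where A: "\<And>q. A q \<subseteq> S" "\<And>q. countable (A q)"
      "\<And>q f. f \<in> S \<Longrightarrow> lev q f - (\<Union>h\<in>A q. lev q h) \<in> null_sets M"
    by metis
  define D where "D = (\<Union>q. A q)"
  have D: "countable D" "D \<subseteq> S"
    using A by (auto simp: D_def)
  define g where "g \<omega> = (SUP f\<in>D. f \<omega>)" for \<omega>
  have "g \<in> borel_measurable M"
    unfolding g_def using D S by (intro borel_measurable_SUP) auto
  moreover have "AE \<omega> in M. f \<omega> \<le> g \<omega>" if f: "f \<in> S" for f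
  proof -
    have "AE \<omega> in M. \<forall>q. \<omega> \<notin> lev q f - (\<Union>h\<in>A q. lev q h)"
      unfolding AE_all_countable by (intro allI AE_not_in A(3) f)
    moreover have "AE \<omega> in M. \<omega> \<in> space M"
      by simp
    ultimately show ?thesis
    proof eventually_elim
      case (elim \<omega>)
      show ?case
      proof (rule ccontr)
        assume "\<not> f \<omega> \<le> g \<omega>"
        then have "g \<omega> < f \<omega>" by simp
        then obtain r where r: "g \<omega> < ereal (real_of_rat r)" "ereal (real_of_rat r) < f \<omega>"
          by (metis ereal_dense3)
        then obtain h where h: "h \<in> A r" "ereal (real_of_rat r) < h \<omega>"
          using elim by (auto simp: lev_def)
        then have "h \<omega> \<le> g \<omega>"
          unfolding g_def by (intro SUP_upper) (auto simp: D_def)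
        then show False
          using h r by auto
      qed
    qed
  qed
  moreover have "AE \<omega> in M. g \<omega> \<le> h \<omega>" if "\<forall>f\<in>S. AE \<omega> in M. f \<omega> \<le> h \<omega>" for h
  proof -
    have "AE \<omega> in M. \<forall>f\<in>D. f \<omega> \<le> h \<omega>"
      using that D by (subst AE_ball_countable) auto
    then show ?thesis
      by eventually_elim (auto simp: g_def intro: SUP_least)
  qed
  ultimately show ?thesis
    unfolding is_ess_Sup_def by blast
qed

text \<open>
  The time-zero variable is not among the generators: index 0 gives the trivial \<open>\<sigma>\<close>-algebra.
\<close>

definition gen_filtration :: "'a measure \<Rightarrow> (nat \<Rightarrow> 'a \<Rightarrow> real) \<Rightarrow> nat \<Rightarrow> 'a measure" where
  "gen_filtration M Y j =
     sigma (space M) (\<Union>k\<in>{1..j}. {Y k -` A \<inter> space M | A. A \<in> sets borel})"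

definition stopping_times_between ::
  "'a measure \<Rightarrow> (nat \<Rightarrow> 'a measure) \<Rightarrow> nat \<Rightarrow> nat \<Rightarrow> ('a \<Rightarrow> nat) set" where
  "stopping_times_between M F j J =
     {\<sigma>. stopping_time F \<sigma> \<and> (\<forall>\<omega>\<in>space M. j \<le> \<sigma> \<omega> \<and> \<sigma> \<omega> \<le> J)}"

text \<open>
  The essential supremum is taken on the restricted space, so that the value process is adapted.
\<close>

definition is_value_process ::
  "'a measure \<Rightarrow> (nat \<Rightarrow> 'a measure) \<Rightarrow> nat \<Rightarrow> (nat \<Rightarrow> 'a \<Rightarrow> real) \<Rightarrow> (nat \<Rightarrow> 'a \<Rightarrow> ereal) \<Rightarrow> bool" where
  "is_value_process M F J Y V \<longleftrightarrow>
     (\<forall>j\<le>J. is_ess_Sup (restr_to_subalg M (F j))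
        {\<lambda>\<omega>. ereal (real_cond_exp M (F j) (\<lambda>\<omega>'. Y (\<sigma> \<omega>') \<omega>') \<omega>) |\<sigma>.
           \<sigma> \<in> stopping_times_between M F j J}
        (V j))"

lemma ex_value_process:
  assumes "finite_measure M" and F: "\<And>j. j \<le> J \<Longrightarrow> subalgebra M (F j)"
  shows "\<exists>V. is_value_process M F J Y V"
proof -
  define S where "S j = {\<lambda>\<omega>. ereal (real_cond_exp M (F j) (\<lambda>\<omega>'. Y (\<sigma> \<omega>') \<omega>') \<omega>) |\<sigma>.
    \<sigma> \<in> stopping_times_between M F j J}" for j
  have "\<exists>g. is_ess_Sup (restr_to_subalg M (F j)) (S j) g" if j: "j \<le> J" for j
  proof (rule finite_measure.ex_is_ess_Sup)
    show "finite_measure (restr_to_subalg M (F j))"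
      using assms(1) F[OF j] by (rule finite_measure_restr_to_subalg[rotated])
    have eq: "borel_measurable (restr_to_subalg M (F j)) = (borel_measurable (F j) :: ('a \<Rightarrow> ereal) set)"
      by (rule measurable_cong_sets[OF sets_restr_to_subalg[OF F[OF j]] refl])
    show "S j \<subseteq> borel_measurable (restr_to_subalg M (F j))"
    proof
      fix h assume "h \<in> S j"
      then obtain \<sigma> where h: "h = (\<lambda>\<omega>. ereal (real_cond_exp M (F j) (\<lambda>\<omega>'. Y (\<sigma> \<omega>') \<omega>') \<omega>))"
        unfolding S_def by blast
      show "h \<in> borel_measurable (restr_to_subalg M (F j))"
        unfolding eq h by (intro borel_measurable_ereal borel_measurable_cond_exp)
    qed
  qed
  then have "\<exists>V. \<forall>j\<le>J. is_ess_Sup (restr_to_subalg M (F j)) (S j) (V j)"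
    by metis
  then show ?thesis
    unfolding is_value_process_def S_def .
qed

lemma subalgebra_gen_filtration:
  assumes "\<And>k. 1 \<le> k \<Longrightarrow> k \<le> j \<Longrightarrow> Y k \<in> borel_measurable M"
  shows "subalgebra M (gen_filtration M Y j)"
proof -
  have "sets (gen_filtration M Y j) \<subseteq> sets M"
    unfolding gen_filtration_def
    using assms by (subst sets_measure_of) (auto intro!: sets.sigma_sets_subset measurable_sets)
  moreover have "space (gen_filtration M Y j) = space M"
    unfolding gen_filtration_def by (rule space_measure_of) auto
  ultimately show ?thesis
    by (simp add: subalgebra_def)
qed

definition std_normal_gamma :: "real \<Rightarrow> real" where
  "std_normal_gamma x = std_normal_density x + x * cdf std_normal_distribution x"

end

theory Submission
  imports Defs "HOL-Real_Asymp.Real_Asymp"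
begin

text \<open>
  Let \<open>R\<^sub>j\<close> be the mean of \<open>\<xi>\<^sub>0, \<dots>, \<xi>\<^sub>j\<close>, let \<open>Z\<^sub>j = R\<^sub>j - \<xi>\<^sub>0\<close> (a function of
  \<open>Y\<^sub>1, \<dots>, Y\<^sub>j\<close>) and let \<open>W\<^sub>j = \<xi>\<^sub>j\<^sub>+\<^sub>1 - R\<^sub>j\<close> be the innovation. Then \<open>Y\<^sub>j\<^sub>+\<^sub>1 = Z\<^sub>j + W\<^sub>j\<close> and
  \<open>Z\<^sub>j\<^sub>+\<^sub>1 = Z\<^sub>j + W\<^sub>j / (j + 2)\<close>, where \<open>W\<^sub>j\<close> is centred normal with variance \<open>(j + 2) / (j + 1)\<close> and
  independent of \<open>\<F>\<^sub>j\<close>. Hence the conditional expectation given \<open>\<F>\<^sub>j\<close> of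
  \<open>max Y\<^sub>j\<^sub>+\<^sub>1 (\<mu>\<^sub>j\<^sub>+\<^sub>2 + Z\<^sub>j\<^sub>+\<^sub>1)\<close> is \<open>Z\<^sub>j\<close> plus a constant, which \<open>E (max N c) = \<gamma> c\<close> for standard normal \<open>N\<close>
  identifies as \<open>\<mu>\<^sub>j\<^sub>+\<^sub>1\<close>; the claim is then backward induction for the Snell envelope.

  The independence comes from an induction on \<open>j\<close>: if \<open>R\<^sub>j\<close> is independent of \<open>\<F>\<^sub>j\<close>, then \<open>\<F>\<^sub>j\<close>, \<open>R\<^sub>j\<close>
  and \<open>\<xi>\<^sub>j\<^sub>+\<^sub>1\<close> are independent, and the pair \<open>(W\<^sub>j, R\<^sub>j\<^sub>+\<^sub>1)\<close> is, up to scaling, a rotation of \<open>(R\<^sub>j, \<xi>\<^sub>j\<^sub>+\<^sub>1)\<close>,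
  hence again a pair of independent normal variables.
\<close>

section \<open>Expectation of the maximum of a normal variable and a constant\<close>

text \<open>The negative density is an antiderivative of the integrand and vanishes at infinity, so
  only the boundary value at \<open>c\<close> remains.\<close>

lemma integral_std_normal_tail:
  "(LBINT x:{c<..}. std_normal_density x * x) = std_normal_density c"
proof -
  have "(LBINT x=ereal c..\<infinity>. std_normal_density x * x) = 0 - (- std_normal_density c)"
  proof (rule interval_integral_FTC_integrable)
    fix x :: real
    have "((\<lambda>x. - std_normal_density x) has_real_derivative std_normal_density x * x) (at x)"
      unfolding std_normal_density_def
      by (auto intro!: derivative_eq_intros simp: field_simps)
    then show "((\<lambda>x. - std_normal_density x) has_vector_derivative std_normal_density x * x) (at x)"
      by (simp add: has_real_derivative_iff_has_vector_derivative)
    show "isCont (\<lambda>x. std_normal_density x * x) x"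
      unfolding std_normal_density_def by (intro continuous_intros) auto
  next
    have "integrable lborel (\<lambda>x. std_normal_density x * x)"
      by (rule integrable_normal_moment_nz_1) simp
    then show "set_integrable lborel (einterval (ereal c) \<infinity>) (\<lambda>x. std_normal_density x * x)"
      unfolding set_integrable_def by (rule integrable_mult_indicator[rotated]) simp
  next
    have "isCont (\<lambda>x. - std_normal_density x) c"
      unfolding std_normal_density_def by (intro continuous_intros) auto
    then show "(((\<lambda>x. - std_normal_density x) \<circ> real_of_ereal) \<longlongrightarrow> - std_normal_density c) (at_right (ereal c))"
      unfolding ereal_tendsto_simps isCont_def by (rule tendsto_within_subset) simp
  next
    have "((\<lambda>x. - std_normal_density x) \<longlongrightarrow> 0) at_top"
      unfolding std_normal_density_def by real_asymp
    then show "(((\<lambda>x. - std_normal_density x) \<circ> real_of_ereal) \<longlongrightarrow> 0) (at_left \<infinity>)"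
      unfolding ereal_tendsto_simps .
  qed simp
  then show ?thesis
    by (simp add: interval_lebesgue_integral_def einterval_eq_Ici)
qed

text \<open>Split at \<open>c\<close>: below it the maximum is constant and contributes
  \<open>c\<close> times the distribution function, above it the tail integral contributes the
  density.\<close>

lemma has_bochner_integral_std_normal_max:
  "has_bochner_integral lborel (\<lambda>x. std_normal_density x * max x c) (std_normal_gamma c)"
proof -
  interpret N: prob_space std_normal_distribution
    by (rule prob_space_normal_density) simp
  have i1: "integrable lborel (\<lambda>x. std_normal_density x * x)"
    by (rule integrable_normal_moment_nz_1) simp
  have i2: "integrable lborel std_normal_density"
    by simp
  have cdf: "cdf std_normal_distribution c = (\<integral>x. std_normal_density x * indicator {..c} x \<partial>lborel)"
  proof -
    have "cdf std_normal_distribution c = (\<integral>x. indicator {..c} x \<partial>std_normal_distribution)"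
      by (simp add: cdf_def)
    also have "\<dots> = (\<integral>x. std_normal_density x * indicator {..c} x \<partial>lborel)"
      by (subst integral_real_density) auto
    finally show ?thesis .
  qed
  have eq: "std_normal_density x * max x c
      = c * (std_normal_density x * indicator {..c} x) + indicator {c<..} x * (std_normal_density x * x)" for x
    by (auto simp: indicator_def max_def)
  have i3: "integrable lborel (\<lambda>x. std_normal_density x * indicator {..c} x)"
    using integrable_mult_indicator[OF _ i2, of "{..c}"] by (simp add: mult.commute)
  have i4: "integrable lborel (\<lambda>x. indicator {c<..} x * (std_normal_density x * x))"
    using integrable_mult_indicator[OF _ i1, of "{c<..}"] by simp
  have "(\<integral>x. indicator {c<..} x * (std_normal_density x * x) \<partial>lborel) = std_normal_density c"
    using integral_std_normal_tail[of c] by (simp add: set_lebesgue_integral_def)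
  then show ?thesis
    unfolding has_bochner_integral_iff eq std_normal_gamma_def cdf
    using i3 i4 by simp
qed

text \<open>\<open>max x c\<close> dominates \<open>x\<close>, which has mean zero. For
  \<open>J > 1\<close> this makes \<open>\<mu> 1\<close> nonnegative, which settles the maximum at
  time 0.\<close>

lemma std_normal_gamma_nonneg: "0 \<le> std_normal_gamma c"
proof -
  have "has_bochner_integral lborel (\<lambda>x. std_normal_density x * x) 0"
    by (rule normal_moment_nz_1) simp
  moreover have "integral\<^sup>L lborel (\<lambda>x. std_normal_density x * x)
      \<le> integral\<^sup>L lborel (\<lambda>x. std_normal_density x * max x c)"
    using has_bochner_integral_std_normal_max[of c] calculation
    by (intro integral_mono) (auto simp: has_bochner_integral_iff intro!: mult_left_mono)
  ultimately show ?thesis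
    using has_bochner_integral_std_normal_max[of c] by (simp add: has_bochner_integral_iff)
qed

text \<open>Pulling the factor \<open>a * s\<close> out of the maximum leaves the standard normal
  \<open>X / s\<close> against the threshold \<open>c / (a * s)\<close>.\<close>

lemma (in prob_space) expectation_max_normal:
  assumes X: "distributed M lborel X (normal_density 0 s)" and "0 < s" "0 < a"
  shows "has_bochner_integral M (\<lambda>\<omega>. max (a * X \<omega>) c) (a * s * std_normal_gamma (c / (a * s)))"
proof -
  have std: "distributed M lborel (\<lambda>\<omega>. X \<omega> / s) std_normal_density"
    using normal_standard_normal_convert[of s X 0] assms by simp
  have "has_bochner_integral M (\<lambda>\<omega>. max (X \<omega> / s) (c / (a * s))) (std_normal_gamma (c / (a * s)))"
    using has_bochner_integral_std_normal_max[of "c / (a * s)"]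
      distributed_integrable[OF std, of "\<lambda>x. max x (c / (a * s))"]
      distributed_integral[OF std, of "\<lambda>x. max x (c / (a * s))"]
    by (simp add: has_bochner_integral_iff)
  then have "has_bochner_integral M (\<lambda>\<omega>. (a * s) * max (X \<omega> / s) (c / (a * s)))
      ((a * s) * std_normal_gamma (c / (a * s)))"
    by (intro has_bochner_integral_mult_right) auto
  moreover have "(a * s) * max (X \<omega> / s) (c / (a * s)) = max (a * X \<omega>) c" for \<omega>
    using assms(2,3) by (auto simp: max_def field_simps)
  ultimately show ?thesis
    by simp
qed

section \<open>Independence of generated sigma-algebras\<close>

text \<open>
  \<^const>\<open>prob_space.indep_var\<close> requires both variables to have the same value type, which excludes
  pairing a random variable with a filtration; independence is therefore stated for set systems.
\<close>

definition preimages :: "'a measure \<Rightarrow> ('a \<Rightarrow> real) \<Rightarrow> 'a set set" where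
  "preimages M X = {X -` A \<inter> space M |A. A \<in> sets borel}"

lemma preimages_subset_sets:
  assumes "X \<in> borel_measurable N" "space N = space M"
  shows "preimages M X \<subseteq> sets N"
  using measurable_sets[OF assms(1)] assms(2) unfolding preimages_def by auto

text \<open>Preimages of a sigma-algebra already form one. Hence \<open>indep_var\<close>, which
  speaks of generated sigma-algebras, translates into \<open>indep_set\<close> of
  \<open>preimages\<close>.\<close>

lemma sigma_sets_preimages: "sigma_sets (space M) (preimages M X) = preimages M X"
  using sigma_sets_vimage_commute[of X "space M" UNIV "sets borel"]
  by (simp add: preimages_def sets.sigma_sets_eq[of borel, simplified])

lemma Int_stable_preimages: "Int_stable (preimages M X)"
  unfolding Int_stable_def preimages_def
  by (clarsimp, rename_tac a b, rule_tac x="a \<inter> b" in exI) auto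

context prob_space
begin

lemma indep_set_mono:
  assumes "indep_set A B" "A' \<subseteq> A" "B' \<subseteq> B"
  shows "indep_set A' B'"
  using assms unfolding indep_sets2_eq by blast

lemma indep_set_sym: "indep_set A B \<Longrightarrow> indep_set B A"
  unfolding indep_sets2_eq by (metis Int_commute mult.commute)

lemma indep_var_iff_preimages:
  "indep_var borel X borel Y \<longleftrightarrow>
     random_variable borel X \<and> random_variable borel Y \<and> indep_set (preimages M X) (preimages M Y)"
  unfolding indep_var_eq preimages_def[symmetric] sigma_sets_preimages by auto

text \<open>Intersections of a member of \<open>F\<close> with a member of \<open>G\<close> form an
  intersection-stable generator, so the product rule has to be checked only on them.\<close>

lemma indep_set_sigma_Un:
  assumes alg: "sigma_algebra (space M) F" "sigma_algebra (space M) G" "sigma_algebra (space M) H"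
    and sub: "F \<subseteq> events" "G \<subseteq> events" "H \<subseteq> events"
    and prob: "\<And>A B C. A \<in> F \<Longrightarrow> B \<in> G \<Longrightarrow> C \<in> H \<Longrightarrow> prob (A \<inter> B \<inter> C) = prob (A \<inter> B) * prob C"
  shows "indep_set (sigma_sets (space M) (F \<union> G)) H"
proof -
  interpret F: sigma_algebra "space M" F by fact
  interpret G: sigma_algebra "space M" G by fact
  interpret H: sigma_algebra "space M" H by fact
  define D where "D = {a \<inter> b |a b. a \<in> F \<and> b \<in> G}"
  have "Int_stable D"
    unfolding D_def Int_stable_def
  proof clarsimp
    fix a b c d assume "a \<in> F" "b \<in> G" "c \<in> F" "d \<in> G"
    then show "\<exists>x y. a \<inter> b \<inter> (c \<inter> d) = x \<inter> y \<and> x \<in> F \<and> y \<in> G"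
      by (intro exI[of _ "a \<inter> c"] exI[of _ "b \<inter> d"]) auto
  qed
  moreover have "indep_set D H"
    unfolding indep_sets2_eq
  proof (intro conjI ballI)
    show "D \<subseteq> events"
      unfolding D_def using sub by auto
    show "prob (d \<inter> c) = prob d * prob c" if "d \<in> D" "c \<in> H" for d c
      using that prob unfolding D_def by auto
  qed (fact sub)
  ultimately have "indep_set (sigma_sets (space M) D) (sigma_sets (space M) H)"
    by (intro indep_set_sigma_sets H.Int_stable)
  \<comment> \<open>A set of one family is its own intersection with the whole space, which lies in
    the other family.\<close>
  moreover have "F \<union> G \<subseteq> D"
  proof
    fix x assume "x \<in> F \<union> G"
    moreover have "x = x \<inter> space M \<and> x = space M \<inter> x" if "x \<in> F \<union> G"
      using that F.space_closed G.space_closed by blast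
    ultimately show "x \<in> D"
      unfolding D_def using F.top G.top by blast
  qed
  then have "sigma_sets (space M) (F \<union> G) \<subseteq> sigma_sets (space M) D"
    by (rule sigma_sets_mono')
  ultimately show ?thesis
    by (rule indep_set_mono) auto
qed

text \<open>The hypotheses give the full product formula for \<open>A \<inter> B \<inter> C\<close>
  and the one for \<open>B \<inter> C\<close>, which can then be bracketed the other way.\<close>

lemma indep_set_assoc:
  assumes alg: "sigma_algebra (space M) F" "sigma_algebra (space M) G" "sigma_algebra (space M) H"
    and FG: "indep_set F G" and FGH: "indep_set (sigma_sets (space M) (F \<union> G)) H"
  shows "indep_set F (sigma_sets (space M) (G \<union> H))"
proof (rule indep_set_sym, rule indep_set_sigma_Un[OF alg(2,3,1)])
  show sub: "F \<subseteq> events" "G \<subseteq> events" "H \<subseteq> events"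
    using FG FGH unfolding indep_sets2_eq by auto
  fix B C A assume sets: "B \<in> G" "C \<in> H" "A \<in> F"
  let ?S = "sigma_sets (space M) (F \<union> G)"
  have "A \<in> ?S" "B \<in> ?S"
    using sets by auto
  moreover have "?S = sets (sigma (space M) (F \<union> G))"
    using sub sets.space_closed[of M] by (subst sets_measure_of) auto
  ultimately have "prob (A \<inter> B \<inter> C) = prob (A \<inter> B) * prob C" "prob (B \<inter> C) = prob B * prob C"
    using FGH sets unfolding indep_sets2_eq by auto
  moreover have "prob (A \<inter> B) = prob A * prob B"
    using FG sets unfolding indep_sets2_eq by auto
  ultimately show "prob (B \<inter> C \<inter> A) = prob (B \<inter> C) * prob A"
    by (simp add: Int_ac mult_ac)
qed

text \<open>The converse regrouping. Between the two, the right-hand pair can be replaced by another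
  pair of independent variables that are functions of it.\<close>

lemma indep_set_assoc':
  assumes alg: "sigma_algebra (space M) F" "sigma_algebra (space M) G" "sigma_algebra (space M) H"
    and FGH: "indep_set F (sigma_sets (space M) (G \<union> H))" and GH: "indep_set G H"
  shows "indep_set (sigma_sets (space M) (F \<union> G)) H"
proof (rule indep_set_sigma_Un[OF alg])
  show sub: "F \<subseteq> events" "G \<subseteq> events" "H \<subseteq> events"
    using GH FGH unfolding indep_sets2_eq by auto
  fix A B C assume sets: "A \<in> F" "B \<in> G" "C \<in> H"
  let ?S = "sigma_sets (space M) (G \<union> H)"
  have "B \<in> ?S" "C \<in> ?S"
    using sets by auto
  moreover have "?S = sets (sigma (space M) (G \<union> H))"
    using sub sets.space_closed[of M] by (subst sets_measure_of) auto
  ultimately have "prob (A \<inter> (B \<inter> C)) = prob A * prob (B \<inter> C)" "prob (A \<inter> B) = prob A * prob B"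
    using FGH sets unfolding indep_sets2_eq by auto
  moreover have "prob (B \<inter> C) = prob B * prob C"
    using GH sets unfolding indep_sets2_eq by auto
  ultimately show "prob (A \<inter> B \<inter> C) = prob (A \<inter> B) * prob C"
    by (simp add: Int_ac mult_ac)
qed

text \<open>The constant is tested against every \<open>A\<close> in \<open>F\<close>: the
  expectation of \<open>indicator A\<close> times \<open>h (W \<omega>)\<close> factors by
  independence.\<close>

lemma real_cond_exp_indep_set:
  fixes W :: "'a \<Rightarrow> real"
  assumes subalg: "subalgebra M F" and indep: "indep_set (sets F) (preimages M W)"
    and W: "W \<in> borel_measurable M" and h: "h \<in> borel_measurable borel" and int: "integrable M (\<lambda>\<omega>. h (W \<omega>))"
  shows "AE \<omega> in M. real_cond_exp M F (\<lambda>\<omega>. h (W \<omega>)) \<omega> = expectation (\<lambda>\<omega>. h (W \<omega>))"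
proof -
  interpret S: finite_measure_subalgebra M F
    by unfold_locales (fact subalg)
  show ?thesis
  proof (rule S.real_cond_exp_charact)
    fix A assume A: "A \<in> sets F"
    then have A': "A \<in> events"
      using subalg by (auto simp: subalgebra_def)
    have ind: "indicator A \<in> borel_measurable F"
      using A by simp
    \<comment> \<open>The real-valued indicator stands in for \<open>F\<close>, so that both
      variables have the same type and \<open>indep_var\<close> applies.\<close>
    have "indep_set (preimages M (indicator A)) (preimages M W)"
      using preimages_subset_sets[OF ind] subalg
      by (intro indep_set_mono[OF indep]) (auto simp: subalgebra_def)
    then have "indep_var borel (indicator A) borel W"
      unfolding indep_var_iff_preimages using A' W by simp
    then have "indep_var borel (id \<circ> indicator A) borel (h \<circ> W)"
      by (rule indep_var_compose) (use h in auto)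
    then have iv: "indep_var borel (indicator A) borel (\<lambda>\<omega>. h (W \<omega>))"
      by (simp add: comp_def)
    have "integrable M (indicator A :: 'a \<Rightarrow> real)"
      using A' by (intro integrable_real_indicator) (auto simp: emeasure_eq_measure)
    from indep_var_lebesgue_integral[OF iv this int]
    show "(\<integral>\<omega>\<in>A. h (W \<omega>) \<partial>M) = (\<integral>\<omega>\<in>A. expectation (\<lambda>\<omega>. h (W \<omega>)) \<partial>M)"
      using A' by (simp add: set_lebesgue_integral_def)
  qed (use int in auto)
qed

end

section \<open>Rotation of independent normal variables\<close>

text \<open>The left side is the joint density of two independent normals \<open>x\<close>,
  \<open>y\<close> in the coordinates \<open>w = y - x\<close> and
  \<open>r = x + a\<^sup>2 / (a\<^sup>2 + b\<^sup>2) * w\<close>; completing squares makes it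
  factor.\<close>

lemma normal_density_rotate:
  fixes a b r w :: real
  assumes "0 < a" "0 < b"
  defines "s \<equiv> sqrt (a\<^sup>2 + b\<^sup>2)"
  shows "normal_density 0 a (r - a\<^sup>2 / (a\<^sup>2 + b\<^sup>2) * w) * normal_density 0 b (r + b\<^sup>2 / (a\<^sup>2 + b\<^sup>2) * w)
    = normal_density 0 s w * normal_density 0 (a * b / s) r"
proof -
  define q where "q = a\<^sup>2 + b\<^sup>2"
  have q: "0 < q" "s\<^sup>2 = q" "q = a\<^sup>2 + b\<^sup>2"
    using assms by (auto simp: q_def add_pos_pos)
  \<comment> \<open>One expansion serves both exponents, with \<open>e = -1\<close> for
    \<open>a\<close> and \<open>e = 1\<close> for \<open>b\<close>. The mixed terms in
    \<open>r * w\<close> then cancel in the sum.\<close>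
  have square: "(r + e * (u / q) * w)\<^sup>2 / (2 * u) = r\<^sup>2 / (2 * u) + e * (r * w / q) + u * w\<^sup>2 / (2 * q\<^sup>2)"
    if "u > 0" "e\<^sup>2 = 1" for u e :: real
  proof -
    have "(r + e * (u / q) * w)\<^sup>2 = r\<^sup>2 + 2 * e * (u / q) * w * r + e\<^sup>2 * (u\<^sup>2 / q\<^sup>2 * w\<^sup>2)"
      by (simp add: power2_eq_square algebra_simps)
    then show ?thesis
      using that q(1) by (simp add: add_divide_distrib power2_eq_square mult_ac)
  qed
  have "r\<^sup>2 / (2 * a\<^sup>2) + r\<^sup>2 / (2 * b\<^sup>2) = r\<^sup>2 * q / (2 * (a\<^sup>2 * b\<^sup>2))"
    unfolding q(3) using assms(1,2) by (simp add: field_simps)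
  moreover have "a\<^sup>2 * w\<^sup>2 / (2 * q\<^sup>2) + b\<^sup>2 * w\<^sup>2 / (2 * q\<^sup>2) = w\<^sup>2 / (2 * q)"
    unfolding add_divide_distrib[symmetric] distrib_right[symmetric] q(3)[symmetric]
    using q(1) by (simp add: power2_eq_square)
  ultimately have "(r - a\<^sup>2 / q * w)\<^sup>2 / (2 * a\<^sup>2) + (r + b\<^sup>2 / q * w)\<^sup>2 / (2 * b\<^sup>2)
      = w\<^sup>2 / (2 * q) + r\<^sup>2 * q / (2 * (a\<^sup>2 * b\<^sup>2))"
    using square[of "a\<^sup>2" "-1"] square[of "b\<^sup>2" 1] assms(1,2) by simp
  then have exps: "- (r - a\<^sup>2 / q * w)\<^sup>2 / (2 * a\<^sup>2) + - (r + b\<^sup>2 / q * w)\<^sup>2 / (2 * b\<^sup>2)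
      = - w\<^sup>2 / (2 * q) + - r\<^sup>2 / (2 * (a\<^sup>2 * b\<^sup>2 / q))"
    by simp
  have coeffs: "1 / sqrt (2 * pi * a\<^sup>2) * (1 / sqrt (2 * pi * b\<^sup>2))
      = 1 / sqrt (2 * pi * q) * (1 / sqrt (2 * pi * (a\<^sup>2 * b\<^sup>2 / q)))"
    using q(1) assms(1,2) by (simp add: real_sqrt_mult real_sqrt_divide)
  have sq: "(a * b / s)\<^sup>2 = a\<^sup>2 * b\<^sup>2 / q"
    using q by (simp add: power_divide power_mult_distrib)
  show ?thesis
    unfolding normal_density_def q(3)[symmetric] sq q(2)
    using arg_cong2[OF arg_cong[OF exps, of exp] coeffs, of times]
    by (simp only: exp_add diff_0_right minus_divide_left mult_ac)
qed

context prob_space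
begin

text \<open>On rectangles with one full side the joint law gives a marginal, since the other factor
  has total mass one.\<close>

lemma distr_eq_of_joint_eq_pair:
  assumes "X \<in> borel_measurable M" "Y \<in> borel_measurable M"
    and "prob_space P" "prob_space Q" and sets: "sets P = sets borel" "sets Q = sets borel"
    and joint: "distr M (borel \<Otimes>\<^sub>M borel) (\<lambda>\<omega>. (X \<omega>, Y \<omega>)) = P \<Otimes>\<^sub>M Q"
  shows "distr M borel X = P" "distr M borel Y = Q"
proof -
  interpret P: prob_space P by fact
  interpret Q: prob_space Q by fact
  have space: "space P = space borel" "space Q = space borel"
    using sets by (auto dest: sets_eq_imp_space_eq)
  have XY[measurable]: "(\<lambda>\<omega>. (X \<omega>, Y \<omega>)) \<in> M \<rightarrow>\<^sub>M borel \<Otimes>\<^sub>M borel"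
    using assms(1,2) by measurable
  have prod: "emeasure P A * emeasure Q B = emeasure M (X -` A \<inter> Y -` B \<inter> space M)"
    if "A \<in> sets borel" "B \<in> sets borel" for A B
  proof -
    have "emeasure P A * emeasure Q B = emeasure (distr M (borel \<Otimes>\<^sub>M borel) (\<lambda>\<omega>. (X \<omega>, Y \<omega>))) (A \<times> B)"
      unfolding joint using that sets by (simp add: Q.emeasure_pair_measure_Times)
    also have "\<dots> = emeasure M ((\<lambda>\<omega>. (X \<omega>, Y \<omega>)) -` (A \<times> B) \<inter> space M)"
      using that by (intro emeasure_distr XY) auto
    also have "(\<lambda>\<omega>. (X \<omega>, Y \<omega>)) -` (A \<times> B) = X -` A \<inter> Y -` B"
      by auto
    finally show ?thesis .
  qed
  show "distr M borel X = P"
  proof (rule measure_eqI)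
    fix A assume "A \<in> sets (distr M borel X)"
    then show "emeasure (distr M borel X) A = emeasure P A"
      using prod[of A UNIV] Q.emeasure_space_1 space assms(1) by (simp add: emeasure_distr)
  qed (simp add: sets)
  show "distr M borel Y = Q"
  proof (rule measure_eqI)
    fix A assume "A \<in> sets (distr M borel Y)"
    then show "emeasure (distr M borel Y) A = emeasure Q A"
      using prod[of UNIV A] P.emeasure_space_1 space assms(2) by (simp add: emeasure_distr)
  qed (simp add: sets)
qed

text \<open>The weight \<open>c\<close> is the one that makes \<open>R'\<close> uncorrelated with
  \<open>W\<close>: the covariance is \<open>c * (a\<^sup>2 + b\<^sup>2) - a\<^sup>2\<close>.
  Independence follows by computing the joint law through two shifts, which leave Lebesgue measure
  invariant.\<close>

lemma indep_normal_rotate: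
  assumes indep: "indep_var borel R borel T" and pos: "0 < a" "0 < b"
    and R: "distributed M lborel R (normal_density 0 a)"
    and T: "distributed M lborel T (normal_density 0 b)"
  defines "s \<equiv> sqrt (a\<^sup>2 + b\<^sup>2)" and "c \<equiv> a\<^sup>2 / (a\<^sup>2 + b\<^sup>2)"
  defines "W \<equiv> \<lambda>\<omega>. T \<omega> - R \<omega>" and "R' \<equiv> \<lambda>\<omega>. R \<omega> + c * (T \<omega> - R \<omega>)"
  shows "indep_var borel W borel R'"
    and "distributed M lborel W (normal_density 0 s)"
    and "distributed M lborel R' (normal_density 0 (a * b / s))"
proof -
  let ?f = "normal_density 0 a" and ?g = "normal_density 0 b"
  let ?k = "normal_density 0 s" and ?h = "normal_density 0 (a * b / s)"
  have s: "0 < s" "0 < a * b / s"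
    using pos by (auto simp: s_def add_pos_pos)
  have c: "1 - c = b\<^sup>2 / (a\<^sup>2 + b\<^sup>2)"
    using pos by (simp add: c_def field_simps add_pos_pos less_imp_neq[symmetric])
  have rv[measurable]: "R \<in> borel_measurable M" "T \<in> borel_measurable M"
    using indep by (auto dest: indep_var_rv1 indep_var_rv2)
  then have rv'[measurable]: "W \<in> borel_measurable M" "R' \<in> borel_measurable M"
    unfolding W_def R'_def by measurable
  interpret K: prob_space "density lborel ?k"
    using s by (intro prob_space_normal_density)
  interpret H: prob_space "density lborel ?h"
    using s by (intro prob_space_normal_density)
  have "indep_var lborel R lborel T"
    using indep by (simp add: indep_var_eq)
  then have joint: "distributed M (lborel \<Otimes>\<^sub>M lborel) (\<lambda>\<omega>. (R \<omega>, T \<omega>)) (\<lambda>(x, y). ennreal (?f x) * ennreal (?g y))"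
    using distributed_joint_indep[OF sigma_finite_lborel sigma_finite_lborel R T] by simp
  have distr: "distr M (borel \<Otimes>\<^sub>M borel) (\<lambda>\<omega>. (W \<omega>, R' \<omega>)) = density lborel ?k \<Otimes>\<^sub>M density lborel ?h"
  proof (rule measure_eqI)
    show "sets (distr M (borel \<Otimes>\<^sub>M borel) (\<lambda>\<omega>. (W \<omega>, R' \<omega>))) = sets (density lborel ?k \<Otimes>\<^sub>M density lborel ?h)"
      by (simp cong: sets_pair_measure_cong)
    fix S assume "S \<in> sets (distr M (borel \<Otimes>\<^sub>M borel) (\<lambda>\<omega>. (W \<omega>, R' \<omega>)))"
    then have S[measurable]: "S \<in> sets (borel \<Otimes>\<^sub>M borel)"
      by simp
    have "emeasure (distr M (borel \<Otimes>\<^sub>M borel) (\<lambda>\<omega>. (W \<omega>, R' \<omega>))) S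
        = (\<integral>\<^sup>+z. indicator S z \<partial>distr M (borel \<Otimes>\<^sub>M borel) (\<lambda>\<omega>. (W \<omega>, R' \<omega>)))"
      by simp
    also have "\<dots> = (\<integral>\<^sup>+\<omega>. indicator S (W \<omega>, R' \<omega>) \<partial>M)"
      by (rule nn_integral_distr) measurable
    also have "\<dots> = (\<integral>\<^sup>+\<omega>. (\<lambda>(x, y). indicator S (y - x, x + c * (y - x))) (R \<omega>, T \<omega>) \<partial>M)"
      by (simp add: W_def R'_def)
    also have "\<dots> = (\<integral>\<^sup>+z. (case z of (x, y) \<Rightarrow> ennreal (?f x) * ennreal (?g y)) *
        (\<lambda>(x, y). indicator S (y - x, x + c * (y - x))) z \<partial>(lborel \<Otimes>\<^sub>M lborel))"
      by (rule distributed_nn_integral[OF joint, symmetric]) measurable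
    also have "\<dots> = (\<integral>\<^sup>+x. \<integral>\<^sup>+y. ennreal (?f x) * ennreal (?g y) * indicator S (y - x, x + c * (y - x)) \<partial>lborel \<partial>lborel)"
      by (subst lborel.nn_integral_fst[symmetric]) auto
    \<comment> \<open>First shift, \<open>y = x + w\<close> with \<open>x\<close> fixed.\<close>
    also have "\<dots> = (\<integral>\<^sup>+x. \<integral>\<^sup>+w. ennreal (?f x) * ennreal (?g (x + w)) * indicator S (w, x + c * w) \<partial>lborel \<partial>lborel)"
    proof (rule nn_integral_cong)
      fix x :: real
      show "(\<integral>\<^sup>+y. ennreal (?f x) * ennreal (?g y) * indicator S (y - x, x + c * (y - x)) \<partial>lborel)
          = (\<integral>\<^sup>+w. ennreal (?f x) * ennreal (?g (x + w)) * indicator S (w, x + c * w) \<partial>lborel)"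
        by (subst nn_integral_real_affine[where c=1 and t=x]) simp_all
    qed
    \<comment> \<open>The order is exchanged so that \<open>w\<close> is fixed during the second
      shift, \<open>x = r - c * w\<close>.\<close>
    also have "\<dots> = (\<integral>\<^sup>+w. \<integral>\<^sup>+x. ennreal (?f x) * ennreal (?g (x + w)) * indicator S (w, x + c * w) \<partial>lborel \<partial>lborel)"
      by (rule lborel_pair.Fubini') measurable
    also have "\<dots> = (\<integral>\<^sup>+w. \<integral>\<^sup>+r. ennreal (?k w) * ennreal (?h r) * indicator S (w, r) \<partial>lborel \<partial>lborel)"
    proof (rule nn_integral_cong)
      fix w :: real
      have "ennreal (?f (- c * w + r)) * ennreal (?g (- c * w + r + w)) = ennreal (?k w) * ennreal (?h r)" for r
      proof -
        have e1: "- c * w + r = r - a\<^sup>2 / (a\<^sup>2 + b\<^sup>2) * w"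
          by (simp add: c_def)
        have e2: "- c * w + r + w = r + b\<^sup>2 / (a\<^sup>2 + b\<^sup>2) * w"
          unfolding c[symmetric] by (simp add: algebra_simps)
        have "?f (- c * w + r) * ?g (- c * w + r + w) = ?k w * ?h r"
          unfolding e2 unfolding e1 s_def by (rule normal_density_rotate[OF pos])
        then show ?thesis
          by (simp add: ennreal_mult[symmetric])
      qed
      then show "(\<integral>\<^sup>+x. ennreal (?f x) * ennreal (?g (x + w)) * indicator S (w, x + c * w) \<partial>lborel)
          = (\<integral>\<^sup>+r. ennreal (?k w) * ennreal (?h r) * indicator S (w, r) \<partial>lborel)"
        by (subst nn_integral_real_affine[where c=1 and t="- c * w"]) simp_all
    qed
    also have "\<dots> = (\<integral>\<^sup>+z. (case z of (w, r) \<Rightarrow> ennreal (?k w) * ennreal (?h r)) * indicator S z \<partial>(lborel \<Otimes>\<^sub>M lborel))"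
      by (subst lborel.nn_integral_fst[symmetric]) auto
    also have "\<dots> = emeasure (density (lborel \<Otimes>\<^sub>M lborel) (\<lambda>(w, r). ennreal (?k w) * ennreal (?h r))) S"
      by (subst emeasure_density) auto
    also have "density (lborel \<Otimes>\<^sub>M lborel) (\<lambda>(w, r). ennreal (?k w) * ennreal (?h r))
        = density lborel ?k \<Otimes>\<^sub>M density lborel ?h"
      by (rule pair_measure_density[symmetric]) (auto intro: sigma_finite_lborel H.sigma_finite_measure_axioms)
    finally show "emeasure (distr M (borel \<Otimes>\<^sub>M borel) (\<lambda>\<omega>. (W \<omega>, R' \<omega>))) S
        = emeasure (density lborel ?k \<Otimes>\<^sub>M density lborel ?h) S" .
  qed
  \<comment> \<open>Independence compares the joint law with the product of the marginals, so the
    factors must first be recognised as the marginals.\<close>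
  note marginals = distr_eq_of_joint_eq_pair[OF rv' K.prob_space_axioms H.prob_space_axioms _ _ distr]
  have W: "distr M borel W = density lborel ?k" and R': "distr M borel R' = density lborel ?h"
    using marginals by simp_all
  show "indep_var borel W borel R'"
    unfolding indep_var_distribution_eq W R' distr by simp
  show "distributed M lborel W ?k" "distributed M lborel R' ?h"
    using W R' unfolding distributed_def by (auto cong: distr_cong)
qed
end

section \<open>Snell envelope in discrete time\<close>

lemma (in prob_space) finite_measure_subalgebraI: "subalgebra M F \<Longrightarrow> finite_measure_subalgebra M F"
  by unfold_locales

text \<open>\<open>C\<close> is a chosen version of the continuation value: it agrees with the
  conditional expectation almost everywhere, while \<open>U_step\<close> holds pointwise. An
  explicit formula can thus be inserted for it.\<close>

locale snell_envelope = prob_space M for M :: "'a measure" +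
  fixes F :: "nat \<Rightarrow> 'a measure" and J :: nat and Y U C :: "nat \<Rightarrow> 'a \<Rightarrow> real"
  assumes space_F: "space (F j) = space M"
    and mono_F: "i \<le> j \<Longrightarrow> sets (F i) \<subseteq> sets (F j)"
    and subalg_F: "j \<le> J \<Longrightarrow> subalgebra M (F j)"
    and Y_measurable: "j \<le> J \<Longrightarrow> Y j \<in> borel_measurable (F j)"
    and Y_integrable: "j \<le> J \<Longrightarrow> integrable M (Y j)"
    and U_measurable: "j \<le> J \<Longrightarrow> U j \<in> borel_measurable (F j)"
    and U_integrable: "j \<le> J \<Longrightarrow> integrable M (U j)"
    and C_measurable: "j < J \<Longrightarrow> C j \<in> borel_measurable (F j)"
    and C_cond_exp: "j < J \<Longrightarrow> AE \<omega> in M. real_cond_exp M (F j) (U (Suc j)) \<omega> = C j \<omega>"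
    and U_last: "U J = Y J"
    and U_step: "j < J \<Longrightarrow> U j \<omega> = max (Y j \<omega>) (C j \<omega>)"
begin

abbreviation stopped :: "('a \<Rightarrow> nat) \<Rightarrow> 'a \<Rightarrow> real" where
  "stopped \<sigma> \<equiv> \<lambda>\<omega>. Y (\<sigma> \<omega>) \<omega>"

abbreviation times_from :: "nat \<Rightarrow> ('a \<Rightarrow> nat) set" where
  "times_from j \<equiv> stopping_times_between M F j J"

text \<open>Stopping on \<open>A\<close> and continuing with \<open>X\<close> elsewhere is the
  common step of both inductions below. As \<open>A\<close> is known at time \<open>j\<close>, its
  indicator leaves the conditional expectation, and the tower property inserts time
  \<open>Suc j\<close>.\<close>

lemma cond_exp_switch:
  assumes j: "j < J" and A: "A \<in> sets (F j)" and X: "integrable M X"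
  defines "S \<equiv> \<lambda>\<omega>. if \<omega> \<in> A then Y j \<omega> else X \<omega>"
  shows "integrable M S"
    and "AE \<omega> in M. real_cond_exp M (F j) S \<omega> =
      (if \<omega> \<in> A then Y j \<omega> else real_cond_exp M (F j) (real_cond_exp M (F (Suc j)) X) \<omega>)"
proof -
  interpret Fj: finite_measure_subalgebra M "F j"
    using subalg_F[of j] j by (intro finite_measure_subalgebraI) simp
  have A': "A \<in> sets M"
    using A subalg_F[of j] j by (auto simp: subalgebra_def)
  define I where "I = (\<lambda>\<omega>. 1 - indicator A \<omega> :: real)"
  have I: "I \<in> borel_measurable (F j)"
    unfolding I_def using A by measurable
  have S: "S = (\<lambda>\<omega>. indicator A \<omega> * Y j \<omega> + I \<omega> * X \<omega>)"
    by (auto simp: S_def I_def indicator_def)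
  have YA: "integrable M (\<lambda>\<omega>. indicator A \<omega> * Y j \<omega>)"
    using integrable_mult_indicator[OF A' Y_integrable[of j]] j by simp
  have "integrable M (\<lambda>\<omega>. X \<omega> - indicator A \<omega> * X \<omega>)"
    using integrable_mult_indicator[OF A' X] X by simp
  then have XI: "integrable M (\<lambda>\<omega>. I \<omega> * X \<omega>)"
    by (simp add: I_def left_diff_distrib)
  show "integrable M S"
    unfolding S using YA XI by simp
  have "AE \<omega> in M. real_cond_exp M (F j) S \<omega>
      = real_cond_exp M (F j) (\<lambda>\<omega>. indicator A \<omega> * Y j \<omega>) \<omega> + real_cond_exp M (F j) (\<lambda>\<omega>. I \<omega> * X \<omega>) \<omega>"
    unfolding S by (rule Fj.real_cond_exp_add[OF YA XI])
  moreover have "AE \<omega> in M. real_cond_exp M (F j) (\<lambda>\<omega>. indicator A \<omega> * Y j \<omega>) \<omega> = indicator A \<omega> * Y j \<omega>"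
    using YA A Y_measurable[of j] j by (intro Fj.real_cond_exp_F_meas) auto
  moreover have "AE \<omega> in M. real_cond_exp M (F j) (\<lambda>\<omega>. I \<omega> * X \<omega>) \<omega> = I \<omega> * real_cond_exp M (F j) X \<omega>"
    using I X XI by (intro Fj.real_cond_exp_mult) auto
  moreover have "AE \<omega> in M. real_cond_exp M (F j) (real_cond_exp M (F (Suc j)) X) \<omega> = real_cond_exp M (F j) X \<omega>"
    using subalg_F[of "Suc j"] j X mono_F[of j "Suc j"] space_F
    by (intro Fj.real_cond_exp_nested_subalg) (auto simp: subalgebra_def)
  ultimately show "AE \<omega> in M. real_cond_exp M (F j) S \<omega> =
      (if \<omega> \<in> A then Y j \<omega> else real_cond_exp M (F j) (real_cond_exp M (F (Suc j)) X) \<omega>)"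
    by eventually_elim (auto simp: I_def)
qed

lemma times_from_last: "\<sigma> \<in> times_from J \<Longrightarrow> \<omega> \<in> space M \<Longrightarrow> \<sigma> \<omega> = J"
  unfolding stopping_times_between_def by (auto intro: antisym)

text \<open>Backward induction from \<open>J\<close>: both \<open>Y j\<close> and \<open>C j\<close>
  lie below \<open>U j\<close>, whichever of stopping or continuing \<open>\<sigma>\<close> chooses.
  Integrability is carried along because \<open>cond_exp_switch\<close> requires it of the continued
  part.\<close>

lemma cond_exp_stopped_le:
  assumes "j \<le> J" and "\<sigma> \<in> times_from j"
  shows "integrable M (stopped \<sigma>) \<and> (AE \<omega> in M. real_cond_exp M (F j) (stopped \<sigma>) \<omega> \<le> U j \<omega>)"
  using assms
proof (induction j arbitrary: \<sigma> rule: inc_induct)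
  case base
  interpret FJ: finite_measure_subalgebra M "F J"
    using subalg_F[of J] by (intro finite_measure_subalgebraI) simp
  have eq: "stopped \<sigma> \<omega> = Y J \<omega>" if "\<omega> \<in> space M" for \<omega>
    using times_from_last[OF base that] by simp
  have int: "integrable M (stopped \<sigma>)"
    using Y_integrable[of J] by (simp add: eq cong: Bochner_Integration.integrable_cong)
  have "AE \<omega> in M. real_cond_exp M (F J) (stopped \<sigma>) \<omega> = real_cond_exp M (F J) (Y J) \<omega>"
    using int Y_integrable[of J] eq by (intro FJ.real_cond_exp_cong) auto
  moreover have "AE \<omega> in M. real_cond_exp M (F J) (Y J) \<omega> = Y J \<omega>"
    using Y_integrable[of J] Y_measurable[of J] by (intro FJ.real_cond_exp_F_meas) auto
  ultimately have "AE \<omega> in M. real_cond_exp M (F J) (stopped \<sigma>) \<omega> \<le> U J \<omega>"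
    by eventually_elim (simp add: U_last)
  with int show ?case ..
next
  case (step j)
  interpret Fj: finite_measure_subalgebra M "F j"
    using subalg_F[of j] step.hyps by (intro finite_measure_subalgebraI) simp
  interpret Fj': finite_measure_subalgebra M "F (Suc j)"
    using subalg_F[of "Suc j"] step.hyps by (intro finite_measure_subalgebraI) simp
  have \<sigma>: "stopping_time F \<sigma>" "\<And>\<omega>. \<omega> \<in> space M \<Longrightarrow> j \<le> \<sigma> \<omega> \<and> \<sigma> \<omega> \<le> J"
    using step.prems by (auto simp: stopping_times_between_def)
  \<comment> \<open>Forcing the time past \<open>j\<close> gives a competitor for the induction
    hypothesis that differs from \<open>\<sigma>\<close> only where \<open>\<sigma>\<close> equals
    \<open>j\<close>.\<close>
  define \<sigma>' where "\<sigma>' = (\<lambda>\<omega>. max (\<sigma> \<omega>) (Suc j))"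
  have \<sigma>': "\<sigma>' \<in> times_from (Suc j)"
    unfolding stopping_times_between_def \<sigma>'_def using \<sigma> step.hyps
    by (auto intro: stopping_time_max stopping_time_const)
  define A where "A = {\<omega> \<in> space (F j). \<sigma> \<omega> \<le> j}"
  have A: "A \<in> sets (F j)"
    unfolding A_def using stopping_timeD[OF \<sigma>(1), of j] by (simp add: pred_def)
  define S where "S = (\<lambda>\<omega>. if \<omega> \<in> A then Y j \<omega> else stopped \<sigma>' \<omega>)"
  have eq: "stopped \<sigma> \<omega> = S \<omega>" if "\<omega> \<in> space M" for \<omega>
    using \<sigma>(2)[OF that] that by (auto simp: S_def A_def \<sigma>'_def space_F max_def not_less_eq_eq)
  have int': "integrable M (stopped \<sigma>')"
    and le: "AE \<omega> in M. real_cond_exp M (F (Suc j)) (stopped \<sigma>') \<omega> \<le> U (Suc j) \<omega>"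
    using step.IH[OF \<sigma>'] by auto
  have int_S: "integrable M S"
    unfolding S_def by (rule cond_exp_switch(1)[OF step.hyps(2) A int'])
  then have int: "integrable M (stopped \<sigma>)"
    by (simp add: eq cong: Bochner_Integration.integrable_cong)
  have "AE \<omega> in M. real_cond_exp M (F j) (stopped \<sigma>) \<omega> = real_cond_exp M (F j) S \<omega>"
    using int int_S eq by (intro Fj.real_cond_exp_cong) auto
  moreover have "AE \<omega> in M. real_cond_exp M (F j) S \<omega> = (if \<omega> \<in> A then Y j \<omega>
      else real_cond_exp M (F j) (real_cond_exp M (F (Suc j)) (stopped \<sigma>')) \<omega>)"
    unfolding S_def by (rule cond_exp_switch(2)[OF step.hyps(2) A int'])
  moreover have "AE \<omega> in M. real_cond_exp M (F j) (real_cond_exp M (F (Suc j)) (stopped \<sigma>')) \<omega>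
      \<le> real_cond_exp M (F j) (U (Suc j)) \<omega>"
    using le Fj'.real_cond_exp_int(1)[OF int'] U_integrable[of "Suc j"] step.hyps
    by (intro Fj.real_cond_exp_mono) auto
  moreover note C_cond_exp[OF step.hyps(2)]
  ultimately have "AE \<omega> in M. real_cond_exp M (F j) (stopped \<sigma>) \<omega> \<le> U j \<omega>"
    by eventually_elim (auto simp: U_step[OF step.hyps(2)] max_def split: if_splits)
  with int show ?case ..
qed

text \<open>The optimal time stops at \<open>j\<close> as soon as the reward reaches the
  continuation value, and otherwise follows the optimal time from \<open>Suc j\<close>.\<close>

lemma cond_exp_stopped_attained:
  assumes "j \<le> J"
  shows "\<exists>\<sigma>\<in>times_from j. AE \<omega> in M. real_cond_exp M (F j) (stopped \<sigma>) \<omega> = U j \<omega>"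
  using assms
proof (induction j rule: inc_induct)
  case base
  interpret FJ: finite_measure_subalgebra M "F J"
    using subalg_F[of J] by (intro finite_measure_subalgebraI) simp
  have "AE \<omega> in M. real_cond_exp M (F J) (Y J) \<omega> = Y J \<omega>"
    using Y_integrable[of J] Y_measurable[of J] by (intro FJ.real_cond_exp_F_meas) auto
  moreover have "(\<lambda>_. J) \<in> times_from J"
    by (auto simp: stopping_times_between_def intro: stopping_time_const)
  ultimately show ?case
    by (intro bexI[of _ "\<lambda>_. J"]) (simp_all add: U_last)
next
  case (step j)
  interpret Fj: finite_measure_subalgebra M "F j"
    using subalg_F[of j] step.hyps by (intro finite_measure_subalgebraI) simp
  interpret Fj': finite_measure_subalgebra M "F (Suc j)"
    using subalg_F[of "Suc j"] step.hyps by (intro finite_measure_subalgebraI) simp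
  obtain \<sigma> where \<sigma>: "\<sigma> \<in> times_from (Suc j)"
    and att: "AE \<omega> in M. real_cond_exp M (F (Suc j)) (stopped \<sigma>) \<omega> = U (Suc j) \<omega>"
    using step.IH by blast
  have \<sigma>': "stopping_time F \<sigma>" "\<And>\<omega>. \<omega> \<in> space M \<Longrightarrow> Suc j \<le> \<sigma> \<omega> \<and> \<sigma> \<omega> \<le> J"
    using \<sigma> by (auto simp: stopping_times_between_def)
  have int': "integrable M (stopped \<sigma>)"
    using cond_exp_stopped_le[OF _ \<sigma>] step.hyps by auto
  define A where "A = {\<omega> \<in> space (F j). C j \<omega> \<le> Y j \<omega>}"
  have A: "A \<in> sets (F j)"
    unfolding A_def using C_measurable[of j] Y_measurable[of j] step.hyps by (intro borel_measurable_le) auto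
  define \<tau> where "\<tau> = (\<lambda>\<omega>. if \<omega> \<in> A then j else \<sigma> \<omega>)"
  have "stopping_time F \<tau>"
  proof
    fix t
    \<comment> \<open>Before \<open>j\<close> nothing has stopped, as \<open>\<sigma>\<close> starts
      at \<open>Suc j\<close>; from \<open>j\<close> on, \<open>A\<close> belongs to the larger
      sigma-algebra \<open>F t\<close>.\<close>
    have "{\<omega> \<in> space (F t). \<tau> \<omega> \<le> t} = (if j \<le> t then A \<union> {\<omega> \<in> space (F t). \<sigma> \<omega> \<le> t} else {})"
      using \<sigma>'(2) sets.sets_into_space[OF A] by (force simp: \<tau>_def space_F)
    also have "\<dots> \<in> sets (F t)"
      using A mono_F[of j t] stopping_timeD[OF \<sigma>'(1), of t] by (auto simp: pred_def)
    finally show "Measurable.pred (F t) (\<lambda>\<omega>. \<tau> \<omega> \<le> t)"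
      by (simp add: pred_def)
  qed
  then have \<tau>: "\<tau> \<in> times_from j"
    using \<sigma>'(2) step.hyps by (force simp: stopping_times_between_def \<tau>_def)
  have eq: "stopped \<tau> = (\<lambda>\<omega>. if \<omega> \<in> A then Y j \<omega> else stopped \<sigma> \<omega>)"
    by (auto simp: \<tau>_def)
  have "AE \<omega> in M. real_cond_exp M (F j) (stopped \<tau>) \<omega> = (if \<omega> \<in> A then Y j \<omega>
      else real_cond_exp M (F j) (real_cond_exp M (F (Suc j)) (stopped \<sigma>)) \<omega>)"
    unfolding eq by (rule cond_exp_switch(2)[OF step.hyps(2) A int'])
  moreover have "AE \<omega> in M. real_cond_exp M (F j) (real_cond_exp M (F (Suc j)) (stopped \<sigma>)) \<omega>
      = real_cond_exp M (F j) (U (Suc j)) \<omega>"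
    using att Fj'.real_cond_exp_int(1)[OF int'] U_integrable[of "Suc j"] step.hyps
    by (intro Fj.real_cond_exp_cong) auto
  moreover note C_cond_exp[OF step.hyps(2)]
  moreover have "AE \<omega> in M. \<omega> \<in> space M"
    by simp
  ultimately have "AE \<omega> in M. real_cond_exp M (F j) (stopped \<tau>) \<omega> = U j \<omega>"
    by eventually_elim (auto simp: U_step[OF step.hyps(2)] A_def space_F max_def split: if_splits)
  with \<tau> show ?case
    by blast
qed

text \<open>\<open>U j\<close> is an upper bound attained by a member of the family. The almost sure
  relations pass to the restricted measure because both sides are measurable in
  \<open>F j\<close>.\<close>

lemma is_ess_Sup_snell_envelope:
  assumes j: "j \<le> J"
  shows "is_ess_Sup (restr_to_subalg M (F j))
    {\<lambda>\<omega>. ereal (real_cond_exp M (F j) (stopped \<sigma>) \<omega>) |\<sigma>. \<sigma> \<in> times_from j} (\<lambda>\<omega>. ereal (U j \<omega>))"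
  unfolding is_ess_Sup_def
proof (intro conjI ballI impI)
  note sub = subalg_F[OF j]
  have meas: "measurable (restr_to_subalg M (F j)) borel = (borel_measurable (F j) :: ('a \<Rightarrow> ereal) set)"
    by (rule measurable_cong_sets[OF sets_restr_to_subalg[OF sub] refl])
  note U_measurable[OF j, measurable]
  show "(\<lambda>\<omega>. ereal (U j \<omega>)) \<in> borel_measurable (restr_to_subalg M (F j))"
    unfolding meas by measurable
  have cond_exp_meas[measurable]: "real_cond_exp M (F j) f \<in> borel_measurable (F j)" for f
    by (rule borel_measurable_cond_exp)
  fix f assume "f \<in> {\<lambda>\<omega>. ereal (real_cond_exp M (F j) (stopped \<sigma>) \<omega>) |\<sigma>. \<sigma> \<in> times_from j}"
  then obtain \<sigma> where f: "f = (\<lambda>\<omega>. ereal (real_cond_exp M (F j) (stopped \<sigma>) \<omega>))" "\<sigma> \<in> times_from j"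
    by blast
  show "AE \<omega> in restr_to_subalg M (F j). f \<omega> \<le> ereal (U j \<omega>)"
    unfolding f(1)
  proof (rule AE_restr_to_subalg2[OF sub])
    show "AE \<omega> in M. ereal (real_cond_exp M (F j) (stopped \<sigma>) \<omega>) \<le> ereal (U j \<omega>)"
      using cond_exp_stopped_le[OF j f(2)] by simp
  qed measurable
next
  note sub = subalg_F[OF j]
  note U_measurable[OF j, measurable]
  have cond_exp_meas[measurable]: "real_cond_exp M (F j) f \<in> borel_measurable (F j)" for f
    by (rule borel_measurable_cond_exp)
  obtain \<sigma> where \<sigma>: "\<sigma> \<in> times_from j"
    and att: "AE \<omega> in M. real_cond_exp M (F j) (stopped \<sigma>) \<omega> = U j \<omega>"
    using cond_exp_stopped_attained[OF j] by blast
  have att': "AE \<omega> in restr_to_subalg M (F j). real_cond_exp M (F j) (stopped \<sigma>) \<omega> = U j \<omega>"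
    by (rule AE_restr_to_subalg2[OF sub att]) measurable
  fix h :: "'a \<Rightarrow> ereal"
  assume "\<forall>f\<in>{\<lambda>\<omega>. ereal (real_cond_exp M (F j) (stopped \<sigma>) \<omega>) |\<sigma>. \<sigma> \<in> times_from j}.
    AE \<omega> in restr_to_subalg M (F j). f \<omega> \<le> h \<omega>"
  then have "AE \<omega> in restr_to_subalg M (F j). ereal (real_cond_exp M (F j) (stopped \<sigma>) \<omega>) \<le> h \<omega>"
    by (rule bspec) (use \<sigma> in blast)
  with att' show "AE \<omega> in restr_to_subalg M (F j). ereal (U j \<omega>) \<le> h \<omega>"
    by eventually_elim simp
qed

end

section \<open>Normal differences and their filtration\<close>

lemma measurable_sigma_preimages:
  assumes "preimages M X \<subseteq> sigma_sets (space M) \<A>" "\<A> \<subseteq> Pow (space M)"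
  shows "X \<in> borel_measurable (sigma (space M) \<A>)"
  using assms by (intro measurableI) (auto simp: preimages_def)

lemma preimages_subset_Pow: "preimages M X \<subseteq> Pow (space M)"
  by (auto simp: preimages_def)

lemma sigma_algebra_preimages: "sigma_algebra (space M) (preimages M X)"
  using sigma_algebra_sigma_sets[OF preimages_subset_Pow[of M X]] by (simp add: sigma_sets_preimages)

lemma space_gen_filtration: "space (gen_filtration M Y j) = space M"
  unfolding gen_filtration_def by (rule space_measure_of) auto

lemma sets_gen_filtration:
  "sets (gen_filtration M Y j) = sigma_sets (space M) (\<Union>k\<in>{1..j}. preimages M (Y k))"
  unfolding gen_filtration_def preimages_def by (rule sets_measure_of) auto

lemma sets_gen_filtration_0: "sets (gen_filtration M Y 0) = {{}, space M}"
  unfolding sets_gen_filtration by (simp add: sigma_sets_empty_eq)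

lemma sets_gen_filtration_mono: "i \<le> j \<Longrightarrow> sets (gen_filtration M Y i) \<subseteq> sets (gen_filtration M Y j)"
  unfolding sets_gen_filtration by (intro sigma_sets_mono' UN_mono) auto

lemma measurable_gen_filtration:
  assumes "1 \<le> k" "k \<le> j"
  shows "Y k \<in> borel_measurable (gen_filtration M Y j)"
proof -
  have "preimages M (Y k) \<subseteq> sets (gen_filtration M Y j)"
    unfolding sets_gen_filtration using assms by (auto intro!: sigma_sets.Basic)
  then show ?thesis
    by (intro measurableI) (auto simp: preimages_def space_gen_filtration)
qed

lemma sets_gen_filtration_subset:
  assumes "\<And>k. 1 \<le> k \<Longrightarrow> k \<le> j \<Longrightarrow> Y k \<in> borel_measurable N" "space N = space M"
  shows "sets (gen_filtration M Y j) \<subseteq> sets N"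
  unfolding sets_gen_filtration assms(2)[symmetric]
proof (rule sets.sigma_sets_subset)
  show "(\<Union>k\<in>{1..j}. preimages M (Y k)) \<subseteq> sets N"
    using assms by (intro UN_least preimages_subset_sets) auto
qed

section \<open>Running means and innovations of the normal sample\<close>

locale std_normal_sample = prob_space M for M :: "'a measure" +
  fixes J :: nat and \<xi> :: "nat \<Rightarrow> 'a \<Rightarrow> real"
  assumes indep_\<xi>: "indep_vars (\<lambda>_. borel) \<xi> {0..J}"
    and normal_\<xi>: "k \<le> J \<Longrightarrow> distributed M lborel (\<xi> k) std_normal_density"
begin

definition Y :: "nat \<Rightarrow> 'a \<Rightarrow> real" where
  "Y j \<omega> = \<xi> j \<omega> - \<xi> 0 \<omega>"

abbreviation F :: "nat \<Rightarrow> 'a measure" where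
  "F \<equiv> gen_filtration M Y"

text \<open>Written through the differences, so that measurability in \<open>F j\<close> is
  immediate. The divisor \<open>Suc j\<close> counts the vanishing term \<open>Y 0\<close>. For
  \<open>j < J\<close> this is the conditional mean of \<open>Y (Suc j)\<close> given
  \<open>F j\<close>.\<close>

definition Z :: "nat \<Rightarrow> 'a \<Rightarrow> real" where
  "Z j \<omega> = (\<Sum>k=1..j. Y k \<omega>) / real (Suc j)"

definition R :: "nat \<Rightarrow> 'a \<Rightarrow> real" where
  "R j \<omega> = (\<Sum>k=0..j. \<xi> k \<omega>) / real (Suc j)"

definition W :: "nat \<Rightarrow> 'a \<Rightarrow> real" where
  "W j \<omega> = \<xi> (Suc j) \<omega> - R j \<omega>"

lemma Z_eq: "Z j \<omega> = R j \<omega> - \<xi> 0 \<omega>"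
proof -
  have "(\<Sum>k=1..j. Y k \<omega>) = (\<Sum>k=0..j. \<xi> k \<omega>) - real (Suc j) * \<xi> 0 \<omega>"
    by (simp add: Y_def sum_subtractf sum.atLeast_Suc_atMost[of 0 j] algebra_simps)
  then show ?thesis
    by (simp add: Z_def R_def diff_divide_distrib)
qed

lemma Y_Suc: "Y (Suc j) \<omega> = Z j \<omega> + W j \<omega>"
  by (simp add: Z_eq Y_def W_def)

text \<open>The weight is \<open>1 / (j + 2)\<close> because \<open>R (Suc j)\<close> averages
  \<open>j + 2\<close> variables.\<close>

lemma R_Suc: "R (Suc j) \<omega> = R j \<omega> + W j \<omega> / real (j + 2)"
proof -
  have "(\<Sum>k=0..j. \<xi> k \<omega>) = real (Suc j) * R j \<omega>"
    by (simp add: R_def)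
  then have "R (Suc j) \<omega> = (real (Suc j) * R j \<omega> + \<xi> (Suc j) \<omega>) / real (j + 2)"
    by (simp add: R_def)
  then show ?thesis
    by (simp add: W_def field_simps)
qed

lemma Z_Suc: "Z (Suc j) \<omega> = Z j \<omega> + W j \<omega> / real (j + 2)"
  by (simp add: Z_eq R_Suc)

lemma measurable_\<xi>[measurable]: "k \<le> J \<Longrightarrow> \<xi> k \<in> borel_measurable M"
  using distributed_measurable[OF normal_\<xi>] by simp

lemma measurable_Y: "k \<le> J \<Longrightarrow> Y k \<in> borel_measurable M"
  unfolding Y_def by measurable

lemma measurable_R: "j \<le> J \<Longrightarrow> R j \<in> borel_measurable M"
  unfolding R_def by measurable

lemma subalgebra_F: "j \<le> J \<Longrightarrow> subalgebra M (F j)"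
  by (rule subalgebra_gen_filtration) (auto intro: measurable_Y)

lemma measurable_Z_F: "Z j \<in> borel_measurable (F j)"
  unfolding Z_def using measurable_gen_filtration[of _ j Y M]
  by (intro borel_measurable_divide borel_measurable_sum) auto

section \<open>Independence of innovation and running mean from the past\<close>

lemma indep_past_next:
  assumes j: "Suc j \<le> J"
  shows "indep_set (sigma_sets (space M) (\<Union>i\<in>{0..j}. preimages M (\<xi> i))) (preimages M (\<xi> (Suc j)))"
proof -
  \<comment> \<open>Two blocks indexed by booleans, matching the \<open>case_bool\<close> family by
    which \<open>indep_set\<close> is defined.\<close>
  define I where "I b = (if b then {0..j} else {Suc j})" for b
  have "indep_sets (\<lambda>i. preimages M (\<xi> i)) {0..J}"
    using indep_\<xi> unfolding indep_vars_def2 preimages_def by simp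
  then have "indep_sets (\<lambda>i. preimages M (\<xi> i)) (\<Union>b\<in>UNIV. I b)"
    by (rule indep_sets_mono_index[rotated]) (use j in \<open>auto simp: I_def split: if_splits\<close>)
  then have "indep_sets (\<lambda>b. sigma_sets (space M) (\<Union>i\<in>I b. preimages M (\<xi> i))) UNIV"
    by (rule indep_sets_collect_sigma)
       (auto simp: Int_stable_preimages disjoint_family_on_def I_def)
  also have "(\<lambda>b. sigma_sets (space M) (\<Union>i\<in>I b. preimages M (\<xi> i)))
      = case_bool (sigma_sets (space M) (\<Union>i\<in>{0..j}. preimages M (\<xi> i))) (preimages M (\<xi> (Suc j)))"
    by (auto simp: fun_eq_iff I_def sigma_sets_preimages split: bool.split)
  finally show ?thesis
    unfolding indep_set_def .
qed

text \<open>The last two conclusions restore the hypotheses at \<open>Suc j\<close>; the first two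
  are what the conditional expectation needs.\<close>

lemma indep_step:
  assumes j: "Suc j \<le> J"
    and indep: "indep_set (sets (F j)) (preimages M (R j))"
    and R: "distributed M lborel (R j) (normal_density 0 (1 / sqrt (real (Suc j))))"
  shows "indep_set (sets (F j)) (preimages M (W j))"
    and "distributed M lborel (W j) (normal_density 0 (sqrt (real (j + 2) / real (j + 1))))"
    and "indep_set (sets (F (Suc j))) (preimages M (R (Suc j)))"
    and "distributed M lborel (R (Suc j)) (normal_density 0 (1 / sqrt (real (Suc (Suc j)))))"
proof -
  let ?\<Omega> = "space M"
  \<comment> \<open>Both \<open>F j\<close> and \<open>R j\<close> are determined by \<xi> up to
    index \<open>j\<close>, so jointly they are independent of the next variable.\<close>
  let ?P = "sigma_sets ?\<Omega> (\<Union>i\<in>{0..j}. preimages M (\<xi> i))"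
  let ?S = "sigma ?\<Omega> (\<Union>i\<in>{0..j}. preimages M (\<xi> i))"
  have sub: "(\<Union>i\<in>{0..j}. preimages M (\<xi> i)) \<subseteq> Pow ?\<Omega>"
    using preimages_subset_Pow[of M] by blast
  have space_S: "space ?S = ?\<Omega>" and sets_S: "sets ?S = ?P"
    using sub by simp_all
  have \<xi>S: "\<xi> i \<in> borel_measurable ?S" if "i \<le> j" for i
    by (rule measurable_sigma_preimages[OF _ sub]) (use that in \<open>auto intro!: sigma_sets.Basic\<close>)
  have RS: "R j \<in> borel_measurable ?S"
    unfolding R_def by (intro borel_measurable_divide borel_measurable_sum \<xi>S) auto
  have "sets (F j) \<subseteq> sets ?S"
    by (rule sets_gen_filtration_subset[OF _ space_S])
       (unfold Y_def, intro borel_measurable_diff \<xi>S, auto)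
  moreover have "preimages M (R j) \<subseteq> sets ?S"
    by (rule preimages_subset_sets[OF RS space_S])
  ultimately have "sets (F j) \<union> preimages M (R j) \<subseteq> ?P"
    unfolding sets_S by simp
  then have "sigma_sets ?\<Omega> (sets (F j) \<union> preimages M (R j)) \<subseteq> ?P"
    by (rule sigma_sets_mono)
  then have indep_\<xi>': "indep_set (sigma_sets ?\<Omega> (sets (F j) \<union> preimages M (R j))) (preimages M (\<xi> (Suc j)))"
    by (rule indep_set_mono[OF indep_past_next[OF j]]) simp
  have alg: "sigma_algebra ?\<Omega> (sets (F j))"
    using sets.sigma_algebra_axioms[of "F j"] by (simp add: space_gen_filtration)
  have FRX: "indep_set (sets (F j)) (sigma_sets ?\<Omega> (preimages M (R j) \<union> preimages M (\<xi> (Suc j))))"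
    by (rule indep_set_assoc[OF alg sigma_algebra_preimages sigma_algebra_preimages indep indep_\<xi>'])

  have "indep_set (preimages M (R j)) (preimages M (\<xi> (Suc j)))"
    by (rule indep_set_mono[OF indep_\<xi>']) auto
  then have RX: "indep_var borel (R j) borel (\<xi> (Suc j))"
    unfolding indep_var_iff_preimages using measurable_R[of j] measurable_\<xi>[of "Suc j"] j by simp
  have X: "distributed M lborel (\<xi> (Suc j)) (normal_density 0 1)"
    by (rule normal_\<xi>[OF j])
  \<comment> \<open>The rotation is applied with standard deviations \<open>1 / sqrt (Suc j)\<close>
    and \<open>1\<close>; its weight \<open>c\<close> is exactly the one in
    \<open>R_Suc\<close>.\<close>
  define s where "s = sqrt ((1 / sqrt (real (Suc j)))\<^sup>2 + 1\<^sup>2)"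
  define c where "c = (1 / sqrt (real (Suc j)))\<^sup>2 / ((1 / sqrt (real (Suc j)))\<^sup>2 + 1\<^sup>2)"
  have s: "s = sqrt (real (j + 2) / real (j + 1))"
    by (simp add: s_def power_divide field_simps)
  have c: "c = 1 / real (j + 2)"
    by (simp add: c_def power_divide field_simps)
  have W_eq: "(\<lambda>\<omega>. \<xi> (Suc j) \<omega> - R j \<omega>) = W j"
    by (simp add: W_def fun_eq_iff)
  have R_eq: "(\<lambda>\<omega>. R j \<omega> + c * (\<xi> (Suc j) \<omega> - R j \<omega>)) = R (Suc j)"
    by (simp add: R_Suc W_def c fun_eq_iff)
  have sR: "1 / sqrt (real (Suc j)) * 1 / s = 1 / sqrt (real (Suc (Suc j)))"
    by (simp add: s real_sqrt_divide)
  note rotate = indep_normal_rotate[OF RX _ _ R X, folded s_def c_def, unfolded W_eq R_eq s[symmetric] sR]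
  show "distributed M lborel (W j) (normal_density 0 (sqrt (real (j + 2) / real (j + 1))))"
    "distributed M lborel (R (Suc j)) (normal_density 0 (1 / sqrt (real (Suc (Suc j)))))"
    using rotate(2,3) s by simp_all
  have WR: "indep_set (preimages M (W j)) (preimages M (R (Suc j)))"
    using rotate(1) unfolding indep_var_iff_preimages by simp

  \<comment> \<open>\<open>W j\<close> and \<open>R (Suc j)\<close> are functions of
    \<open>R j\<close> and \<open>\<xi> (Suc j)\<close>, so the pair inherits independence from
    \<open>F j\<close>.\<close>
  let ?G = "preimages M (R j) \<union> preimages M (\<xi> (Suc j))"
  have subG: "?G \<subseteq> Pow ?\<Omega>"
    using preimages_subset_Pow[of M] by blast
  have spaceG: "space (sigma ?\<Omega> ?G) = ?\<Omega>" and setsG: "sets (sigma ?\<Omega> ?G) = sigma_sets ?\<Omega> ?G"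
    using subG by simp_all
  have RG: "R j \<in> borel_measurable (sigma ?\<Omega> ?G)" and XG: "\<xi> (Suc j) \<in> borel_measurable (sigma ?\<Omega> ?G)"
    by (auto intro!: measurable_sigma_preimages subG)
  have WG: "W j \<in> borel_measurable (sigma ?\<Omega> ?G)"
    unfolding W_def by (intro borel_measurable_diff RG XG)
  have RG': "R (Suc j) \<in> borel_measurable (sigma ?\<Omega> ?G)"
    unfolding R_Suc by (intro borel_measurable_add borel_measurable_divide RG WG) simp
  have "preimages M (W j) \<union> preimages M (R (Suc j)) \<subseteq> sigma_sets ?\<Omega> ?G"
    using preimages_subset_sets[OF WG spaceG] preimages_subset_sets[OF RG' spaceG] setsG by simp
  then have "sigma_sets ?\<Omega> (preimages M (W j) \<union> preimages M (R (Suc j))) \<subseteq> sigma_sets ?\<Omega> ?G"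
    by (rule sigma_sets_mono)
  then have FWR: "indep_set (sets (F j)) (sigma_sets ?\<Omega> (preimages M (W j) \<union> preimages M (R (Suc j))))"
    by (rule indep_set_mono[OF FRX order_refl])
  then show "indep_set (sets (F j)) (preimages M (W j))"
    by (rule indep_set_mono) auto
  have indep': "indep_set (sigma_sets ?\<Omega> (sets (F j) \<union> preimages M (W j))) (preimages M (R (Suc j)))"
    by (rule indep_set_assoc'[OF alg sigma_algebra_preimages sigma_algebra_preimages FWR WR])

  \<comment> \<open>\<open>Y (Suc j)\<close> is \<open>Z j + W j\<close>, hence
    \<open>F (Suc j)\<close> is contained in the sigma-algebra generated by \<open>F j\<close> and
    \<open>W j\<close>.\<close>
  let ?H = "sets (F j) \<union> preimages M (W j)"
  have subH: "?H \<subseteq> Pow ?\<Omega>"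
    using preimages_subset_Pow[of M "W j"] sets.space_closed[of "F j"] by (simp add: space_gen_filtration)
  have spaceH: "space (sigma ?\<Omega> ?H) = ?\<Omega>" and setsH: "sets (sigma ?\<Omega> ?H) = sigma_sets ?\<Omega> ?H"
    using subH by simp_all
  have WH: "W j \<in> borel_measurable (sigma ?\<Omega> ?H)"
    by (auto intro!: measurable_sigma_preimages subH)
  have FH: "f \<in> borel_measurable (sigma ?\<Omega> ?H)" if "f \<in> borel_measurable (F j)" for f :: "'a \<Rightarrow> real"
    using that by (rule measurable_from_subalg[rotated]) (auto simp: subalgebra_def setsH spaceH space_gen_filtration)
  have "sets (F (Suc j)) \<subseteq> sets (sigma ?\<Omega> ?H)"
  proof (rule sets_gen_filtration_subset[OF _ spaceH])
    fix k assume k: "1 \<le> k" "k \<le> Suc j"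
    show "Y k \<in> borel_measurable (sigma ?\<Omega> ?H)"
    proof (cases "k = Suc j")
      case True
      have "(\<lambda>\<omega>. Z j \<omega> + W j \<omega>) \<in> borel_measurable (sigma ?\<Omega> ?H)"
        by (intro borel_measurable_add FH WH measurable_Z_F)
      then show ?thesis
        using True by (simp add: Y_Suc[abs_def])
    next
      case False
      then show ?thesis
        using k by (intro FH measurable_gen_filtration) auto
    qed
  qed
  then show "indep_set (sets (F (Suc j))) (preimages M (R (Suc j)))"
    unfolding setsH by (rule indep_set_mono[OF indep']) simp
qed

text \<open>The induction starts because \<open>F 0\<close> is trivial and thus independent of
  everything, with \<open>R 0\<close> equal to \<open>\<xi> 0\<close>.\<close>

lemma indep_R:
  assumes "j \<le> J"
  shows "indep_set (sets (F j)) (preimages M (R j)) \<and>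
    distributed M lborel (R j) (normal_density 0 (1 / sqrt (real (Suc j))))"
  using assms
proof (induction j)
  case 0
  have R: "R 0 = \<xi> 0"
    by (simp add: R_def fun_eq_iff)
  have "preimages M (\<xi> 0) \<subseteq> events"
    using measurable_\<xi>[of 0] by (intro preimages_subset_sets) auto
  then show ?case
    using normal_\<xi>[of 0] unfolding R indep_sets2_eq sets_gen_filtration_0
    by (auto simp: prob_space)
next
  case (Suc j)
  then show ?case
    using indep_step(3,4)[of j] by simp
qed

lemma
  assumes "j < J"
  shows indep_W: "indep_set (sets (F j)) (preimages M (W j))"
    and normal_W: "distributed M lborel (W j) (normal_density 0 (sqrt (real (j + 2) / real (j + 1))))"
  using assms indep_R[of j] indep_step(1,2)[of j] by auto

end

section \<open>The explicit Snell envelope\<close>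

locale std_normal_stopping = std_normal_sample M J \<xi> for M :: "'a measure" and J \<xi> +
  fixes \<mu> :: "nat \<Rightarrow> real"
  assumes J_pos: "1 \<le> J" and \<mu>_last: "\<mu> J = 0"
    and \<mu>_step: "1 \<le> j \<Longrightarrow> j < J \<Longrightarrow>
      \<mu> j = sqrt (real j / real (j + 1)) * std_normal_gamma (\<mu> (j + 1) * sqrt (real (j + 1) / real j))"
begin

text \<open>The explicit continuation value. For \<open>j < J\<close> it involves only the constants
  fixed by the recursion, and \<open>Z 0 = 0\<close> makes \<open>C 0\<close> the constant
  \<open>\<mu> 1\<close>.\<close>

definition C :: "nat \<Rightarrow> 'a \<Rightarrow> real" where
  "C j \<omega> = \<mu> (Suc j) + Z j \<omega>"

definition U :: "nat \<Rightarrow> 'a \<Rightarrow> real" where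
  "U j \<omega> = (if j < J then max (Y j \<omega>) (C j \<omega>) else Y j \<omega>)"

lemma measurable_Y_F: "Y j \<in> borel_measurable (F j)"
proof (cases "j = 0")
  case True
  then have "Y j = (\<lambda>_. 0)"
    by (simp add: Y_def fun_eq_iff)
  then show ?thesis
    by simp
next
  case False
  then show ?thesis
    by (intro measurable_gen_filtration) auto
qed

lemma measurable_C_F: "C j \<in> borel_measurable (F j)"
  unfolding C_def by (intro borel_measurable_add measurable_Z_F) simp

lemma measurable_U_F: "U j \<in> borel_measurable (F j)"
  unfolding U_def using measurable_Y_F[of j] measurable_C_F[of j] by (cases "j < J") auto

lemma integrable_\<xi>: "k \<le> J \<Longrightarrow> integrable M (\<xi> k)"
  by (rule distributed_integrable_var[OF normal_\<xi>])
     (auto intro: integrable_normal_moment_nz_1)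

lemma integrable_Y: "k \<le> J \<Longrightarrow> integrable M (Y k)"
  unfolding Y_def by (intro Bochner_Integration.integrable_diff integrable_\<xi>) auto

lemma integrable_Z: "k \<le> J \<Longrightarrow> integrable M (Z k)"
  unfolding Z_def by (intro integrable_divide_zero Bochner_Integration.integrable_sum integrable_Y) auto

lemma integrable_U: "k \<le> J \<Longrightarrow> integrable M (U k)"
  unfolding U_def C_def using integrable_Y[of k] integrable_Z[of k] by (cases "k < J") auto

section \<open>Conditional expectation of the explicit envelope\<close>

lemma expectation_W:
  assumes "j < J"
  shows "has_bochner_integral M (W j) 0"
proof -
  have "0 < sqrt (real (j + 2) / real (j + 1))"
    by simp
  from normal_W[OF assms] distributed_integrable_var[OF normal_W[OF assms]]
    normal_distributed_expectation[OF this normal_W[OF assms]] integrable_normal_moment_nz_1[OF this, of 0]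
  show ?thesis
    by (simp add: has_bochner_integral_iff)
qed

text \<open>What remains of \<open>U (Suc j)\<close> once \<open>Z j\<close> is taken out, as a
  function of the innovation. The second branch is the terminal time, where only stopping is
  left.\<close>

definition increment :: "nat \<Rightarrow> real \<Rightarrow> real" where
  "increment j w = (if Suc j < J then max w (\<mu> (j + 2) + w / real (j + 2)) else w)"

lemma U_Suc: "Suc j \<le> J \<Longrightarrow> U (Suc j) \<omega> = Z j \<omega> + increment j (W j \<omega>)"
  by (auto simp: U_def C_def increment_def Y_Suc Z_Suc max_def)

text \<open>At the terminal step the mean is 0, the value of \<open>\<mu> J\<close>. Otherwise
  \<open>w / (j + 2)\<close> is taken out of the maximum; it has mean zero, and
  \<open>expectation_max_normal\<close> evaluates the rest as the recursion at
  \<open>Suc j\<close>.\<close>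

lemma expectation_increment:
  assumes "j < J"
  shows "has_bochner_integral M (\<lambda>\<omega>. increment j (W j \<omega>)) (\<mu> (Suc j))"
proof (cases "Suc j < J")
  case False
  then have "Suc j = J"
    using assms by simp
  then show ?thesis
    using expectation_W[OF assms] \<mu>_last by (simp add: increment_def)
next
  case True
  define a where "a = real (j + 1) / real (j + 2)"
  define s where "s = sqrt (real (j + 2) / real (j + 1))"
  have pos: "0 < s" "0 < a"
    by (auto simp: s_def a_def)
  have as: "a * s = sqrt (real (j + 1) / real (j + 2))"
  proof -
    define q where "q = sqrt (real (j + 1) / real (j + 2))"
    have "a = q * q" "q * s = 1"
      by (simp_all add: a_def q_def s_def real_sqrt_divide)
    then show ?thesis
      unfolding q_def[symmetric] by (simp add: mult.assoc)
  qed
  \<comment> \<open>\<open>a\<close> is the reciprocal of the square of \<open>s\<close>, so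
    dividing by \<open>a * s\<close> multiplies by \<open>s\<close>, as inside the
    recursion.\<close>
  have inv: "x / (a * s) = x * s" for x
    unfolding as by (simp add: s_def real_sqrt_divide)
  have "has_bochner_integral M (\<lambda>\<omega>. W j \<omega> / real (j + 2) + max (a * W j \<omega>) (\<mu> (j + 2)))
      (0 / real (j + 2) + a * s * std_normal_gamma (\<mu> (j + 2) / (a * s)))"
    using normal_W[OF assms] pos unfolding s_def[symmetric]
    by (intro has_bochner_integral_add has_bochner_integral_divide_zero expectation_W[OF assms]
        expectation_max_normal) auto
  moreover have "increment j w = w / real (j + 2) + max (a * w) (\<mu> (j + 2))" for w
  proof -
    have "w / real (j + 2) + a * w = (w + real (j + 1) * w) / real (j + 2)"
      by (simp only: a_def add_divide_distrib times_divide_eq_left)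
    also have "\<dots> = w"
      by (simp add: field_simps)
    finally have "w = w / real (j + 2) + a * w" ..
    then show ?thesis
      using True unfolding increment_def by (simp add: max_def)
  qed
  moreover have "\<mu> (Suc j) = a * s * std_normal_gamma (\<mu> (j + 2) / (a * s))"
    using \<mu>_step[of "Suc j"] True unfolding inv unfolding as unfolding s_def by simp
  ultimately show ?thesis
    by simp
qed

text \<open>\<open>Z j\<close> is known at time \<open>j\<close>, and the increment is independent
  of \<open>F j\<close>, so it contributes its mean.\<close>

lemma cond_exp_U_Suc:
  assumes j: "j < J"
  shows "AE \<omega> in M. real_cond_exp M (F j) (U (Suc j)) \<omega> = C j \<omega>"
proof -
  interpret S: finite_measure_subalgebra M "F j"
    using subalgebra_F[of j] j by (intro finite_measure_subalgebraI) simp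
  let ?h = "\<lambda>\<omega>. increment j (W j \<omega>)"
  have int: "integrable M ?h" "expectation ?h = \<mu> (Suc j)"
    using expectation_increment[OF j] by (auto simp: has_bochner_integral_iff)
  have Z: "integrable M (Z j)"
    using j by (intro integrable_Z) simp
  have "W j \<in> borel_measurable M"
    unfolding W_def using j by (intro borel_measurable_diff measurable_\<xi> measurable_R) auto
  moreover have "increment j \<in> borel_measurable borel"
    unfolding increment_def by measurable
  ultimately have "AE \<omega> in M. real_cond_exp M (F j) ?h \<omega> = \<mu> (Suc j)"
    using real_cond_exp_indep_set[OF S.subalg indep_W[OF j], of "increment j"] int by simp
  moreover have "AE \<omega> in M. real_cond_exp M (F j) (Z j) \<omega> = Z j \<omega>"
    by (rule S.real_cond_exp_F_meas[OF Z measurable_Z_F])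
  moreover have "AE \<omega> in M. real_cond_exp M (F j) (\<lambda>\<omega>. Z j \<omega> + ?h \<omega>) \<omega>
      = real_cond_exp M (F j) (Z j) \<omega> + real_cond_exp M (F j) ?h \<omega>"
    by (rule S.real_cond_exp_add[OF Z int(1)])
  moreover have "U (Suc j) = (\<lambda>\<omega>. Z j \<omega> + ?h \<omega>)"
    using j by (simp add: U_Suc fun_eq_iff)
  ultimately show ?thesis
    by (auto simp: C_def)
qed

sublocale snell_envelope M F J Y U C
proof
  show "space (F j) = space M" for j
    by (rule space_gen_filtration)
  show "sets (F i) \<subseteq> sets (F j)" if "i \<le> j" for i j
    using that by (rule sets_gen_filtration_mono)
qed (auto simp: U_def fun_eq_iff intro: subalgebra_F measurable_Y_F integrable_Y measurable_U_F integrable_U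
    measurable_C_F cond_exp_U_Suc)

section \<open>From the explicit envelope to the value process\<close>

lemma U_0: "U 0 \<omega> = \<mu> 1"
proof -
  \<comment> \<open>\<open>Y 0\<close> and \<open>Z 0\<close> vanish, so the maximum compares 0 with
    \<open>\<mu> 1\<close>. For \<open>J = 1\<close> the two agree.\<close>
  have "0 \<le> \<mu> 1"
    using J_pos \<mu>_last \<mu>_step[of 1] std_normal_gamma_nonneg by (cases "J = 1") auto
  then show ?thesis
    using J_pos by (simp add: U_def C_def Y_def Z_def)
qed

lemma value_process_eq:
  assumes "is_value_process M F J Y V" "j \<le> J"
  shows "AE \<omega> in restr_to_subalg M (F j). V j \<omega> = ereal (U j \<omega>)"
  using assms(1)[unfolded is_value_process_def, rule_format, OF assms(2)]
    is_ess_Sup_snell_envelope[OF assms(2)]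
  by (rule is_ess_Sup_unique)

end

theorem proposition3:
  fixes M :: "'a measure" and J :: nat
    and \<xi> :: "nat \<Rightarrow> 'a \<Rightarrow> real" and Y :: "nat \<Rightarrow> 'a \<Rightarrow> real"
    and V :: "nat \<Rightarrow> 'a \<Rightarrow> ereal" and \<mu> :: "nat \<Rightarrow> real"
  assumes "prob_space M"
    and "J \<ge> 1"
    and "prob_space.indep_vars M (\<lambda>_. borel) \<xi> {0..J}"
    and "\<And>k. k \<le> J \<Longrightarrow> distributed M lborel (\<xi> k) std_normal_density"
    and "\<And>j \<omega>. Y j \<omega> = \<xi> j \<omega> - \<xi> 0 \<omega>"
    and "is_value_process M (gen_filtration M Y) J Y V"
    and "\<mu> J = 0"
    and "\<And>j. 1 \<le> j \<Longrightarrow> j < J \<Longrightarrow>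
           \<mu> j = sqrt (real j / real (j + 1)) *
                 std_normal_gamma (\<mu> (j + 1) * sqrt (real (j + 1) / real j))"
  shows "(\<forall>j\<in>{1..J - 1}. AE \<omega> in M.
            V j \<omega> = ereal (max (\<xi> j \<omega> - \<xi> 0 \<omega>)
              (\<mu> (j + 1) + real j / real (j + 1) * ((\<Sum>k=1..j. \<xi> k \<omega>) / real j - \<xi> 0 \<omega>)))) \<and>
         (\<forall>\<omega>\<in>space M. V 0 \<omega> = ereal (\<mu> 1))"
proof -
  interpret prob_space M
    by fact
  interpret S: std_normal_stopping M J \<xi> \<mu>
    using assms by unfold_locales auto
  have Y: "Y = S.Y"
    using assms(5) by (simp add: S.Y_def fun_eq_iff)
  note V = S.value_process_eq[OF assms(6)[unfolded Y]]
  show ?thesis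
  proof (intro conjI ballI)
    fix j assume j: "j \<in> {1..J - 1}"
    then have "j < J"
      by auto
    then have "AE \<omega> in M. V j \<omega> = ereal (S.U j \<omega>)"
      using AE_restr_to_subalg[OF S.subalgebra_F V] by auto
    moreover have "S.U j \<omega> = max (\<xi> j \<omega> - \<xi> 0 \<omega>)
        (\<mu> (j + 1) + real j / real (j + 1) * ((\<Sum>k=1..j. \<xi> k \<omega>) / real j - \<xi> 0 \<omega>))" for \<omega>
    proof -
      \<comment> \<open>The mean of the first \<open>j\<close> variables is multiplied back by
        \<open>j\<close>, which is legitimate as \<open>j\<close> is at least 1 here.\<close>
      have "S.Z j \<omega> = real j / real (j + 1) * ((\<Sum>k=1..j. \<xi> k \<omega>) / real j - \<xi> 0 \<omega>)"
        using j by (simp add: S.Z_def S.Y_def sum_subtractf right_diff_distrib diff_divide_distrib)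
      then show ?thesis
        using \<open>j < J\<close> by (simp add: S.U_def S.C_def S.Y_def)
    qed
    ultimately show "AE \<omega> in M. V j \<omega> = ereal (max (\<xi> j \<omega> - \<xi> 0 \<omega>)
        (\<mu> (j + 1) + real j / real (j + 1) * ((\<Sum>k=1..j. \<xi> k \<omega>) / real j - \<xi> 0 \<omega>)))"
      by simp
  next
    \<comment> \<open>At time 0 the exceptional set is covered by a null set of the trivial
      sigma-algebra, which must be empty; this turns almost everywhere into everywhere.\<close>
    have "AE \<omega> in restr_to_subalg M (S.F 0). V 0 \<omega> = ereal (\<mu> 1)"
      using V[of 0] by (simp add: S.U_0)
    then obtain N where N: "{\<omega> \<in> space M. V 0 \<omega> \<noteq> ereal (\<mu> 1)} \<subseteq> N"
        "N \<in> null_sets (restr_to_subalg M (S.F 0))"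
      by (auto simp: eventually_ae_filter space_restr_to_subalg)
    then have "N \<in> null_sets M" "N \<in> {{}, space M}"
      using null_sets_restr_to_subalg[OF S.subalgebra_F[of 0]] by (auto simp: sets_gen_filtration_0)
    then have "N = {}"
      using emeasure_space_1 by (auto simp: null_sets_def)
    then show "V 0 \<omega> = ereal (\<mu> 1)" if "\<omega> \<in> space M" for \<omega>
      using N(1) that by auto
  qed
qed

end
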